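(* Let $F=(F^*\dashv F_*:\mathcal B\to\mathcal A)$ be an adjunction between categories $\mathcal A,\mathcal B$ in which all idempotents split. Then the induced adjunction $\mathrm{Nuc}(F)=\big(F^{\sharp}\dashv F_{\sharp}:\mathrm{Alg}(F)\to\mathrm{Coalg}(F)\big)$, where $F_\sharp=\kappa^0\circ U_F$ and $F^\sharp=\kappa_1\circ V^F$, is nuclear: the right adjoint $F_\sharp$ is monadic and the left adjoint $F^\sharp$ is comonadic.
   Context: An adjunction $F=(F^*\dashv F_*:\mathcal B\to\mathcal A)$ consists of a left adjoint $F^*:\mathcal A\to\mathcal B$, a right adjoint $F_*:\mathcal B\to\mathcal A$, a unit $\eta:\mathrm{Id}\to F_*F^*$ and a counit $\varepsilon:F^*F_*\to\mathrm{Id}$. $\mathrm{Alg}(F)$ is the (Eilenberg–Moore) category of algebras for the monad $F_*F^*$ on $\mathcal A$, with forgetful functor $U_F:\mathrm{Alg}(F)\to\mathcal A$; $\mathrm{Coalg}(F)$ is the category of coalgebras for the comonad $F^*F_*$ on $\mathcal B$, with forgetful functor $V^F:\mathrm{Coalg}(F)\to\mathcal B$. The comparison functors are $\kappa^0:\mathcal A\to\mathrm{Coalg}(F)$, $a\mapsto(F^*a\xrightarrow{F^*\eta_a}F^*F_*F^*a)$, and $\kappa_1:\mathcal B\to\mathrm{Alg}(F)$, $b\mapsto(F_*F^*F_*b\xrightarrow{F_*\varepsilon_b}F_*b)$. Thus $F_\sharp$ sends an algebra $\alpha:F_*F^*x\to x$ to the coalgebra $F^*\eta_x:F^*x\to F^*F_*F^*x$,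 and $F^\sharp$ sends a coalgebra $\beta:y\to F^*F_*y$ to the algebra $F_*\varepsilon_y:F_*F^*F_*y\to F_*y$. The adjunction $F^\sharp\dashv F_\sharp$ is given by the natural bijection sending an algebra homomorphism $f:F^\sharp\beta\to\alpha$ (an arrow $f:F_*y\to x$ of $\mathcal A$) to the coalgebra homomorphism $F^*f\circ\beta:\beta\to F_\sharp\alpha$. For an adjunction $G=(G^*\dashv G_*:\mathcal D\to\mathcal C)$: $G_*$ is monadic if the comparison functor $\mathcal D\to\mathrm{Alg}(G)$ is an equivalence of categories; $G^*$ is comonadic if the comparison functor $\mathcal C\to\mathrm{Coalg}(G)$ is an equivalence. $G$ is nuclear if $G_*$ is monadic and $G^*$ is comonadic. *)

theory Defs
  imports Main
begin

section \<open>Categories, functors, natural transformations\<close>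

record ('o, 'm) category =
  Obj :: "'o set"
  Arr :: "'m set"
  Dom :: "'m \<Rightarrow> 'o"
  Cod :: "'m \<Rightarrow> 'o"
  Id :: "'o \<Rightarrow> 'm"
  Comp :: "'m \<Rightarrow> 'm \<Rightarrow> 'm"

definition Hom :: "('o, 'm) category \<Rightarrow> 'o \<Rightarrow> 'o \<Rightarrow> 'm set" where
  "Hom C x y = {f \<in> Arr C. Dom C f = x \<and> Cod C f = y}"

text \<open>\<open>Comp C g f\<close> is ``\<open>g\<close> after \<open>f\<close>''; its value is only meaningful when \<open>Cod C f = Dom C g\<close>.\<close>

locale category =
  fixes C :: "('o, 'm) category"
  assumes Dom_Obj: "f \<in> Arr C \<Longrightarrow> Dom C f \<in> Obj C"
    and Cod_Obj: "f \<in> Arr C \<Longrightarrow> Cod C f \<in> Obj C"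
    and Id_Hom: "x \<in> Obj C \<Longrightarrow> Id C x \<in> Hom C x x"
    and Comp_Hom: "f \<in> Hom C x y \<Longrightarrow> g \<in> Hom C y z \<Longrightarrow> Comp C g f \<in> Hom C x z"
    and Comp_Id: "f \<in> Hom C x y \<Longrightarrow> Comp C f (Id C x) = f"
    and Id_Comp: "f \<in> Hom C x y \<Longrightarrow> Comp C (Id C y) f = f"
    and Comp_assoc: "f \<in> Hom C w x \<Longrightarrow> g \<in> Hom C x y \<Longrightarrow> h \<in> Hom C y z \<Longrightarrow>
        Comp C h (Comp C g f) = Comp C (Comp C h g) f"

definition is_iso :: "('o, 'm) category \<Rightarrow> 'm \<Rightarrow> bool" where
  "is_iso C f \<longleftrightarrow> f \<in> Arr C \<and>
     (\<exists>g \<in> Hom C (Cod C f) (Dom C f).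
        Comp C g f = Id C (Dom C f) \<and> Comp C f g = Id C (Cod C f))"

definition idempotents_split :: "('o, 'm) category \<Rightarrow> bool" where
  "idempotents_split C \<longleftrightarrow>
     (\<forall>x \<in> Obj C. \<forall>e \<in> Hom C x x. Comp C e e = e \<longrightarrow>
        (\<exists>y \<in> Obj C. \<exists>r \<in> Hom C x y. \<exists>s \<in> Hom C y x.
           Comp C s r = e \<and> Comp C r s = Id C y))"

record ('o1, 'm1, 'o2, 'm2) cfunctor =
  fobj :: "'o1 \<Rightarrow> 'o2"
  farr :: "'m1 \<Rightarrow> 'm2"

locale cfunctor =
  source: category C + target: category D
  for C :: "('o1, 'm1) category" and D :: "('o2, 'm2) category" +
  fixes F :: "('o1, 'm1, 'o2, 'm2) cfunctor"
  assumes fobj_Obj: "x \<in> Obj C \<Longrightarrow> fobj F x \<in> Obj D"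
    and farr_Hom: "f \<in> Hom C x y \<Longrightarrow> farr F f \<in> Hom D (fobj F x) (fobj F y)"
    and farr_Id: "x \<in> Obj C \<Longrightarrow> farr F (Id C x) = Id D (fobj F x)"
    and farr_Comp: "f \<in> Hom C x y \<Longrightarrow> g \<in> Hom C y z \<Longrightarrow>
        farr F (Comp C g f) = Comp D (farr F g) (farr F f)"

definition id_functor :: "('o, 'm, 'o, 'm) cfunctor" where
  "id_functor = \<lparr>fobj = (\<lambda>x. x), farr = (\<lambda>f. f)\<rparr>"

definition comp_functor ::
  "('o2, 'm2, 'o3, 'm3) cfunctor \<Rightarrow> ('o1, 'm1, 'o2, 'm2) cfunctor \<Rightarrow>
   ('o1, 'm1, 'o3, 'm3) cfunctor" (infixr "\<circ>\<^sub>F" 55) where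
  "G \<circ>\<^sub>F F = \<lparr>fobj = (\<lambda>x. fobj G (fobj F x)), farr = (\<lambda>f. farr G (farr F f))\<rparr>"

locale nat_trans =
  source_functor: cfunctor C D F + target_functor: cfunctor C D G
  for C :: "('o1, 'm1) category" and D :: "('o2, 'm2) category"
    and F G :: "('o1, 'm1, 'o2, 'm2) cfunctor" +
  fixes \<tau> :: "'o1 \<Rightarrow> 'm2"
  assumes component_Hom: "x \<in> Obj C \<Longrightarrow> \<tau> x \<in> Hom D (fobj F x) (fobj G x)"
    and naturality: "f \<in> Hom C x y \<Longrightarrow>
        Comp D (\<tau> y) (farr F f) = Comp D (farr G f) (\<tau> x)"

locale nat_iso = nat_trans +
  assumes component_iso: "x \<in> Obj C \<Longrightarrow> is_iso D (\<tau> x)"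

definition is_equivalence ::
  "('o1, 'm1) category \<Rightarrow> ('o2, 'm2) category \<Rightarrow> ('o1, 'm1, 'o2, 'm2) cfunctor \<Rightarrow> bool" where
  "is_equivalence C D K \<longleftrightarrow> cfunctor C D K \<and>
     (\<exists>L \<phi> \<psi>. cfunctor D C L \<and>
        nat_iso C C id_functor (L \<circ>\<^sub>F K) \<phi> \<and>
        nat_iso D D (K \<circ>\<^sub>F L) id_functor \<psi>)"


section \<open>Adjunctions\<close>

text \<open>
  An adjunction \<open>F = (F\<^sup>* \<stileturn> F\<^sub>* : \<B> \<rightarrow> \<A>)\<close>: the left adjoint \<open>ladj F\<close> goes from
  \<open>\<A> = catA F\<close> to \<open>\<B> = catB F\<close>, the right adjoint \<open>radj F\<close> goes back.
\<close>

record ('oa, 'ma, 'ob, 'mb) adjunction =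
  catA :: "('oa, 'ma) category"
  catB :: "('ob, 'mb) category"
  ladj :: "('oa, 'ma, 'ob, 'mb) cfunctor"
  radj :: "('ob, 'mb, 'oa, 'ma) cfunctor"
  unit\<^sub>\<eta> :: "'oa \<Rightarrow> 'ma"
  counit\<^sub>\<epsilon> :: "'ob \<Rightarrow> 'mb"

locale adjunction =
  fixes F :: "('oa, 'ma, 'ob, 'mb) adjunction"
  assumes ladj_functor: "cfunctor (catA F) (catB F) (ladj F)"
    and radj_functor: "cfunctor (catB F) (catA F) (radj F)"
    and unit_nat_trans: "nat_trans (catA F) (catA F) id_functor (radj F \<circ>\<^sub>F ladj F) (unit\<^sub>\<eta> F)"
    and counit_nat_trans: "nat_trans (catB F) (catB F) (ladj F \<circ>\<^sub>F radj F) id_functor (counit\<^sub>\<epsilon> F)"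
    and triangle_ladj: "a \<in> Obj (catA F) \<Longrightarrow>
        Comp (catB F) (counit\<^sub>\<epsilon> F (fobj (ladj F) a)) (farr (ladj F) (unit\<^sub>\<eta> F a))
          = Id (catB F) (fobj (ladj F) a)"
    and triangle_radj: "b \<in> Obj (catB F) \<Longrightarrow>
        Comp (catA F) (farr (radj F) (counit\<^sub>\<epsilon> F b)) (unit\<^sub>\<eta> F (fobj (radj F) b))
          = Id (catA F) (fobj (radj F) b)"

text \<open>The bijection \<open>\<B>(F\<^sup>* a, b) \<rightarrow> \<A>(a, F\<^sub>* b)\<close> determined by the unit.\<close>

definition transpose :: "('oa, 'ma, 'ob, 'mb) adjunction \<Rightarrow> 'oa \<Rightarrow> 'mb \<Rightarrow> 'ma" where
  "transpose F a g = Comp (catA F) (farr (radj F) g) (unit\<^sub>\<eta> F a)"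


section \<open>Eilenberg--Moore categories and comparison functors\<close>

text \<open>
  An algebra is a pair of its carrier and its structure map. Arrows carry their source and
  target, since one arrow of the base category may be a homomorphism between several algebras.
\<close>

type_synonym ('o, 'm) alg = "'o \<times> 'm"
type_synonym ('o, 'm) alg_hom = "('o, 'm) alg \<times> 'm \<times> ('o, 'm) alg"

definition is_algebra ::
  "('o, 'm) category \<Rightarrow> ('o, 'm, 'o, 'm) cfunctor \<Rightarrow> ('o \<Rightarrow> 'm) \<Rightarrow> ('o \<Rightarrow> 'm) \<Rightarrow>
   ('o, 'm) alg \<Rightarrow> bool" where
  "is_algebra C T \<eta> \<mu> = (\<lambda>(x, \<alpha>).
     x \<in> Obj C \<and> \<alpha> \<in> Hom C (fobj T x) x \<and>
     Comp C \<alpha> (\<eta> x) = Id C x \<and>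
     Comp C \<alpha> (farr T \<alpha>) = Comp C \<alpha> (\<mu> x))"

definition is_algebra_hom ::
  "('o, 'm) category \<Rightarrow> ('o, 'm, 'o, 'm) cfunctor \<Rightarrow> ('o, 'm) alg_hom \<Rightarrow> bool" where
  "is_algebra_hom C T = (\<lambda>((x, \<alpha>), f, (y, \<beta>)).
     f \<in> Hom C x y \<and> Comp C f \<alpha> = Comp C \<beta> (farr T f))"

definition is_coalgebra ::
  "('o, 'm) category \<Rightarrow> ('o, 'm, 'o, 'm) cfunctor \<Rightarrow> ('o \<Rightarrow> 'm) \<Rightarrow> ('o \<Rightarrow> 'm) \<Rightarrow>
   ('o, 'm) alg \<Rightarrow> bool" where
  "is_coalgebra C S \<epsilon> \<delta> = (\<lambda>(y, \<beta>).
     y \<in> Obj C \<and> \<beta> \<in> Hom C y (fobj S y) \<and>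
     Comp C (\<epsilon> y) \<beta> = Id C y \<and>
     Comp C (farr S \<beta>) \<beta> = Comp C (\<delta> y) \<beta>)"

definition is_coalgebra_hom ::
  "('o, 'm) category \<Rightarrow> ('o, 'm, 'o, 'm) cfunctor \<Rightarrow> ('o, 'm) alg_hom \<Rightarrow> bool" where
  "is_coalgebra_hom C S = (\<lambda>((x, \<alpha>), f, (y, \<beta>)).
     f \<in> Hom C x y \<and> Comp C (farr S f) \<alpha> = Comp C \<beta> f)"

text \<open>The category with object set \<open>X\<close>, whose arrows are those triples satisfying \<open>P\<close> and whose
  identities and composition are inherited from \<open>C\<close>.\<close>

definition structured_cat ::
  "('o, 'm) category \<Rightarrow> ('o, 'm) alg set \<Rightarrow> (('o, 'm) alg_hom \<Rightarrow> bool) \<Rightarrow>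
   (('o, 'm) alg, ('o, 'm) alg_hom) category" where
  "structured_cat C X P =
     \<lparr>Obj = X,
      Arr = {(a, f, b). a \<in> X \<and> b \<in> X \<and> P (a, f, b)},
      Dom = (\<lambda>(a, f, b). a),
      Cod = (\<lambda>(a, f, b). b),
      Id = (\<lambda>a. (a, Id C (fst a), a)),
      Comp = (\<lambda>(b, g, c) (a, f, b'). (a, Comp C g f, c))\<rparr>"

text \<open>The multiplication of the monad \<open>F\<^sub>* F\<^sup>*\<close> is \<open>F\<^sub>* \<epsilon> F\<^sup>*\<close>, the comultiplication of the
  comonad \<open>F\<^sup>* F\<^sub>*\<close> is \<open>F\<^sup>* \<eta> F\<^sub>*\<close>.\<close>

definition Alg :: "('oa, 'ma, 'ob, 'mb) adjunction \<Rightarrow> (('oa, 'ma) alg, ('oa, 'ma) alg_hom) category" where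
  "Alg F = structured_cat (catA F)
     {a. is_algebra (catA F) (radj F \<circ>\<^sub>F ladj F) (unit\<^sub>\<eta> F)
           (\<lambda>x. farr (radj F) (counit\<^sub>\<epsilon> F (fobj (ladj F) x))) a}
     (is_algebra_hom (catA F) (radj F \<circ>\<^sub>F ladj F))"

definition Coalg :: "('oa, 'ma, 'ob, 'mb) adjunction \<Rightarrow> (('ob, 'mb) alg, ('ob, 'mb) alg_hom) category" where
  "Coalg F = structured_cat (catB F)
     {b. is_coalgebra (catB F) (ladj F \<circ>\<^sub>F radj F) (counit\<^sub>\<epsilon> F)
           (\<lambda>y. farr (ladj F) (unit\<^sub>\<eta> F (fobj (radj F) y))) b}
     (is_coalgebra_hom (catB F) (ladj F \<circ>\<^sub>F radj F))"

text \<open>Both forgetful functors \<open>U\<^sub>F : Alg(F) \<rightarrow> \<A>\<close> and \<open>V\<^sup>F : Coalg(F) \<rightarrow> \<B>\<close> are this projection.\<close>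

definition forget :: "(('o, 'm) alg, ('o, 'm) alg_hom, 'o, 'm) cfunctor" where
  "forget = \<lparr>fobj = fst, farr = (\<lambda>(a, f, b). f)\<rparr>"

definition kappa0_obj :: "('oa, 'ma, 'ob, 'mb) adjunction \<Rightarrow> 'oa \<Rightarrow> ('ob, 'mb) alg" where
  "kappa0_obj F a = (fobj (ladj F) a, farr (ladj F) (unit\<^sub>\<eta> F a))"

definition kappa0 ::
  "('oa, 'ma, 'ob, 'mb) adjunction \<Rightarrow> ('oa, 'ma, ('ob, 'mb) alg, ('ob, 'mb) alg_hom) cfunctor" where
  "kappa0 F =
     \<lparr>fobj = kappa0_obj F,
      farr = (\<lambda>f. (kappa0_obj F (Dom (catA F) f), farr (ladj F) f, kappa0_obj F (Cod (catA F) f)))\<rparr>"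

definition kappa1_obj :: "('oa, 'ma, 'ob, 'mb) adjunction \<Rightarrow> 'ob \<Rightarrow> ('oa, 'ma) alg" where
  "kappa1_obj F b = (fobj (radj F) b, farr (radj F) (counit\<^sub>\<epsilon> F b))"

definition kappa1 ::
  "('oa, 'ma, 'ob, 'mb) adjunction \<Rightarrow> ('ob, 'mb, ('oa, 'ma) alg, ('oa, 'ma) alg_hom) cfunctor" where
  "kappa1 F =
     \<lparr>fobj = kappa1_obj F,
      farr = (\<lambda>g. (kappa1_obj F (Dom (catB F) g), farr (radj F) g, kappa1_obj F (Cod (catB F) g)))\<rparr>"

definition monadic :: "('oa, 'ma, 'ob, 'mb) adjunction \<Rightarrow> bool" where
  "monadic G \<longleftrightarrow> is_equivalence (catB G) (Alg G) (kappa1 G)"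

definition comonadic :: "('oa, 'ma, 'ob, 'mb) adjunction \<Rightarrow> bool" where
  "comonadic G \<longleftrightarrow> is_equivalence (catA G) (Coalg G) (kappa0 G)"

definition nuclear :: "('oa, 'ma, 'ob, 'mb) adjunction \<Rightarrow> bool" where
  "nuclear G \<longleftrightarrow> monadic G \<and> comonadic G"


section \<open>The nucleus\<close>

definition lower_sharp ::
  "('oa, 'ma, 'ob, 'mb) adjunction \<Rightarrow>
   (('oa, 'ma) alg, ('oa, 'ma) alg_hom, ('ob, 'mb) alg, ('ob, 'mb) alg_hom) cfunctor" where
  "lower_sharp F = kappa0 F \<circ>\<^sub>F forget"

definition upper_sharp ::
  "('oa, 'ma, 'ob, 'mb) adjunction \<Rightarrow>
   (('ob, 'mb) alg, ('ob, 'mb) alg_hom, ('oa, 'ma) alg, ('oa, 'ma) alg_hom) cfunctor" where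
  "upper_sharp F = kappa1 F \<circ>\<^sub>F forget"

text \<open>
  The bijection \<open>f \<mapsto> F\<^sup>* f \<circ> \<beta>\<close> sends the identity of \<open>F\<^sup>\<sharp> \<beta>\<close> to \<open>\<beta>\<close>, which is therefore the
  component of the unit at \<open>\<beta>\<close>. It sends \<open>\<alpha> : F\<^sup>\<sharp> F\<^sub>\<sharp> \<alpha> \<rightarrow> \<alpha>\<close> to
  \<open>F\<^sup>* \<alpha> \<circ> F\<^sup>* \<eta>\<^sub>x = id\<close>, so \<open>\<alpha>\<close> is the component of the counit at \<open>\<alpha>\<close>.
\<close>

definition Nuc ::
  "('oa, 'ma, 'ob, 'mb) adjunction \<Rightarrow>
   (('ob, 'mb) alg, ('ob, 'mb) alg_hom, ('oa, 'ma) alg, ('oa, 'ma) alg_hom) adjunction" where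
  "Nuc F =
     \<lparr>catA = Coalg F,
      catB = Alg F,
      ladj = upper_sharp F,
      radj = lower_sharp F,
      unit\<^sub>\<eta> = (\<lambda>b. (b, snd b, fobj (lower_sharp F) (fobj (upper_sharp F) b))),
      counit\<^sub>\<epsilon> = (\<lambda>a. (fobj (upper_sharp F) (fobj (lower_sharp F) a), snd a, a))\<rparr>"

lemma transpose_Nuc:
  assumes "(fobj (upper_sharp F) (y, \<beta>), f, (x, \<alpha>)) \<in> Arr (Alg F)"
  shows "transpose (Nuc F) (y, \<beta>) (fobj (upper_sharp F) (y, \<beta>), f, (x, \<alpha>)) =
    ((y, \<beta>), Comp (catB F) (farr (ladj F) f) \<beta>, fobj (lower_sharp F) (x, \<alpha>))"
proof -
  have "Cod (catA F) f = x"
    using assms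
    by (auto simp: Alg_def structured_cat_def is_algebra_hom_def Hom_def split: prod.splits)
  then show ?thesis
    by (simp add: transpose_def Nuc_def lower_sharp_def comp_functor_def forget_def kappa0_def
        Coalg_def structured_cat_def)
qed

end

(* Full faithfulness of the comparison functor Alg(F) -> Alg(Nuc(F)) holds for any adjunction,
   because an algebra x is a retract of F_* F^* x: a morphism h : F^* x -> F^* x' of nucleus
   algebras is F^* of  alpha' . F_* h . eta_x.  Essential surjectivity needs one splitting:
   a nucleus algebra theta : F^* F_* y -> y on a coalgebra beta induces the idempotent
   F_* theta . eta  on F_* y in A, whose image under F^* is  beta . theta,  an idempotent that
   splits through y.  If x splits the former, then F^* x is isomorphic to y.
   Comonadicity is dual. *)

theory Submission
  imports Defs
begin

section \<open>Categories and functors\<close>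

text \<open>Write \<open>L\<close>, \<open>R\<close> for the left and right adjoint. The monad of
  \<open>Nuc F\<close> sends a coalgebra \<open>(y, \<beta>)\<close> to the cofree coalgebra on
  \<open>y\<close>, with carrier \<open>L (R y)\<close>; its unit is \<open>\<beta>\<close> and its
  multiplication is \<open>L (R (\<epsilon> y))\<close>. A nucleus algebra is thus an arrow
  \<open>\<theta>\<close> with a unit law, an associativity law, and the condition of being a
  coalgebra homomorphism. This last condition is exactly the equation that identifies the image of
  the idempotent under \<open>L\<close> with \<open>\<beta>\<close> after \<open>\<theta>\<close>.
  The obstacle is that \<open>L\<close> need not be faithful: equations in the first category cannot
  be read off from their images, so idempotency has to be proved there. Associativity of
  \<open>\<theta>\<close> supplies it: after the idempotent, \<open>R (\<epsilon> y)\<close> and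
  \<open>R \<theta>\<close> become equal. The same equation makes the free algebra structure on
  \<open>R y\<close> descend to the splitting object.\<close>

lemma HomI: "f \<in> Arr C \<Longrightarrow> Dom C f = x \<Longrightarrow> Cod C f = y \<Longrightarrow> f \<in> Hom C x y"
  by (simp add: Hom_def)

lemma HomD:
  assumes "f \<in> Hom C x y"
  shows "f \<in> Arr C" "Dom C f = x" "Cod C f = y"
  using assms by (simp_all add: Hom_def)

context category
begin

declare Dom_Obj [simp] Cod_Obj [simp]

lemma Id_simps [simp]:
  assumes "x \<in> Obj C"
  shows "Id C x \<in> Arr C" "Dom C (Id C x) = x" "Cod C (Id C x) = x"
  using Id_Hom[OF assms] by (simp_all add: Hom_def)

text \<open>With \<open>Hom\<close> as premise the simplifier would have to guess the objects in
  between; in terms of \<open>Arr\<close>, \<open>Dom\<close> and \<open>Cod\<close> all typing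
  conditions are settled by rewriting.\<close>

lemma Comp_simps [simp]:
  assumes "f \<in> Arr C" "g \<in> Arr C" "Cod C f = Dom C g"
  shows "Comp C g f \<in> Arr C" "Dom C (Comp C g f) = Dom C f" "Cod C (Comp C g f) = Cod C g"
  using Comp_Hom[of f "Dom C f" "Dom C g" g "Cod C g"] assms by (simp_all add: Hom_def)

lemma Comp_Id_Arr [simp]: "f \<in> Arr C \<Longrightarrow> Dom C f = x \<Longrightarrow> Comp C f (Id C x) = f"
  by (rule Comp_Id) (simp add: Hom_def)

lemma Id_Comp_Arr [simp]: "f \<in> Arr C \<Longrightarrow> Cod C f = x \<Longrightarrow> Comp C (Id C x) f = f"
  by (rule Id_Comp) (simp add: Hom_def)

lemma Comp_assoc_Arr [simp]:
  assumes "f \<in> Arr C" "g \<in> Arr C" "h \<in> Arr C" "Cod C f = Dom C g" "Cod C g = Dom C h"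
  shows "Comp C (Comp C h g) f = Comp C h (Comp C g f)"
  using Comp_assoc[of f "Dom C f" "Dom C g" g "Dom C h" h "Cod C h"] assms
  by (simp add: Hom_def)

text \<open>Composites are normalised to right-nested form, where the left side of an equation
  \<open>g . f = k . h\<close> is no longer a subterm once something precedes \<open>f\<close>. This
  lemma and \<open>Comp_eq\<close> restate such an equation with a tail \<open>t\<close>.\<close>

lemma Comp_eq_Comp:
  assumes "Comp C g f = Comp C k h" "t \<in> Arr C" "f \<in> Arr C" "g \<in> Arr C" "h \<in> Arr C" "k \<in> Arr C"
    "Cod C t = Dom C f" "Cod C f = Dom C g" "Cod C t = Dom C h" "Cod C h = Dom C k"
  shows "Comp C g (Comp C f t) = Comp C k (Comp C h t)"
  using assms by (metis Comp_assoc_Arr)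

lemma Comp_eq:
  assumes "Comp C g f = k" "t \<in> Arr C" "f \<in> Arr C" "g \<in> Arr C"
    "Cod C t = Dom C f" "Cod C f = Dom C g"
  shows "Comp C g (Comp C f t) = Comp C k t"
  using assms by (metis Comp_assoc_Arr)

lemma is_isoI:
  assumes "f \<in> Hom C x y" "g \<in> Hom C y x" "Comp C g f = Id C x" "Comp C f g = Id C y"
  shows "is_iso C f"
  using assms by (auto simp: is_iso_def Hom_def)

lemma is_isoE:
  assumes "is_iso C f" "f \<in> Hom C x y"
  obtains g where "g \<in> Hom C y x" "Comp C g f = Id C x" "Comp C f g = Id C y"
  using assms by (auto simp: is_iso_def Hom_def)

text \<open>Needed for comonadicity: dualising reverses the isomorphism that witnesses essential
  surjectivity.\<close>

lemma is_iso_inverse: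
  assumes "is_iso C f" "f \<in> Hom C x y"
  shows "\<exists>g \<in> Hom C y x. is_iso C g"
  using is_isoE[OF assms] is_isoI assms(2) by metis

end

context cfunctor
begin

lemma functor_simps [simp]:
  shows "x \<in> Obj C \<Longrightarrow> fobj F x \<in> Obj D"
    and "f \<in> Arr C \<Longrightarrow> farr F f \<in> Arr D"
    and "f \<in> Arr C \<Longrightarrow> Dom D (farr F f) = fobj F (Dom C f)"
    and "f \<in> Arr C \<Longrightarrow> Cod D (farr F f) = fobj F (Cod C f)"
    and "x \<in> Obj C \<Longrightarrow> farr F (Id C x) = Id D (fobj F x)"
  using fobj_Obj farr_Hom[of f "Dom C f" "Cod C f"] farr_Id by (simp_all add: Hom_def)

lemma farr_Comp_Arr [simp]:
  "f \<in> Arr C \<Longrightarrow> g \<in> Arr C \<Longrightarrow> Cod C f = Dom C g \<Longrightarrow>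
    farr F (Comp C g f) = Comp D (farr F g) (farr F f)"
  by (rule farr_Comp[of _ "Dom C f" "Dom C g" _ "Cod C g"]) (simp_all add: Hom_def)

end

lemma id_functor_simps [simp]: "fobj id_functor x = x" "farr id_functor f = f"
  by (simp_all add: id_functor_def)

lemma comp_functor_simps [simp]:
  "fobj (G \<circ>\<^sub>F F) x = fobj G (fobj F x)" "farr (G \<circ>\<^sub>F F) f = farr G (farr F f)"
  by (simp_all add: comp_functor_def)

lemma cfunctor_id: "category C \<Longrightarrow> cfunctor C C id_functor"
  by (simp add: cfunctor_def cfunctor_axioms_def)

lemma cfunctor_comp:
  assumes "cfunctor C D F" "cfunctor D E G"
  shows "cfunctor C E (G \<circ>\<^sub>F F)"
proof -
  interpret F: cfunctor C D F by fact
  interpret G: cfunctor D E G by fact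
  show ?thesis
    by unfold_locales (auto simp: Hom_def)
qed

text \<open>The quasi-inverse picks, for each object \<open>d\<close>, an object \<open>L d\<close> and an isomorphism
  \<open>i d : K (L d) \<rightarrow> d\<close>; everything else is forced by full faithfulness.\<close>

lemma is_equivalenceI:
  assumes "cfunctor C D K"
    and faithful: "\<And>x y f g. f \<in> Hom C x y \<Longrightarrow> g \<in> Hom C x y \<Longrightarrow> farr K f = farr K g \<Longrightarrow> f = g"
    and full: "\<And>x y h. x \<in> Obj C \<Longrightarrow> y \<in> Obj C \<Longrightarrow> h \<in> Hom D (fobj K x) (fobj K y) \<Longrightarrow>
      \<exists>f \<in> Hom C x y. farr K f = h"
    and ess_surj: "\<And>d. d \<in> Obj D \<Longrightarrow> \<exists>c \<in> Obj C. \<exists>i \<in> Hom D (fobj K c) d. is_iso D i"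
  shows "is_equivalence C D K"
proof -
  interpret K: cfunctor C D K by fact
  have "\<exists>c i. d \<in> Obj D \<longrightarrow> c \<in> Obj C \<and> i \<in> Hom D (fobj K c) d \<and> is_iso D i" for d
    using ess_surj by blast
  then obtain Lo i where Li: "\<And>d. d \<in> Obj D \<Longrightarrow>
      Lo d \<in> Obj C \<and> i d \<in> Hom D (fobj K (Lo d)) d \<and> is_iso D (i d)"
    by metis
  then have Lo [simp]: "Lo d \<in> Obj C" and i: "i d \<in> Hom D (fobj K (Lo d)) d"
    and iso: "is_iso D (i d)" if "d \<in> Obj D" for d
    using that by blast+
  have i_simps [simp]: "i d \<in> Arr D" "Dom D (i d) = fobj K (Lo d)" "Cod D (i d) = d"
    if "d \<in> Obj D" for d
    using i[OF that] by (simp_all add: Hom_def)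
  have "\<exists>j. d \<in> Obj D \<longrightarrow> j \<in> Hom D d (fobj K (Lo d)) \<and>
      Comp D j (i d) = Id D (fobj K (Lo d)) \<and> Comp D (i d) j = Id D d" for d
    using K.target.is_isoE[OF iso i] by metis
  then obtain j where j: "\<And>d. d \<in> Obj D \<Longrightarrow> j d \<in> Hom D d (fobj K (Lo d)) \<and>
      Comp D (j d) (i d) = Id D (fobj K (Lo d)) \<and> Comp D (i d) (j d) = Id D d"
    by metis
  have j_simps [simp]: "j d \<in> Arr D" "Dom D (j d) = d" "Cod D (j d) = fobj K (Lo d)"
    "Comp D (j d) (i d) = Id D (fobj K (Lo d))" "Comp D (i d) (j d) = Id D d"
    if "d \<in> Obj D" for d
    using j[OF that] by (simp_all add: Hom_def)
  have ij: "Comp D (i d) (Comp D (j d) t) = t" if "t \<in> Arr D" "Cod D t = d" for d t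
  proof -
    have d: "d \<in> Obj D" using that by auto
    show ?thesis
      using K.target.Comp_eq[of "i d" "j d" "Id D d" t] that d by simp
  qed
  \<comment> \<open>The quasi-inverse on arrows: conjugate \<open>t\<close> by the chosen
    isomorphisms and lift the result along \<open>K\<close> by fullness.\<close>
  have "\<exists>f. t \<in> Arr D \<longrightarrow> f \<in> Hom C (Lo (Dom D t)) (Lo (Cod D t)) \<and>
      farr K f = Comp D (j (Cod D t)) (Comp D t (i (Dom D t)))" for t
  proof (cases "t \<in> Arr D")
    case True
    then have "Comp D (j (Cod D t)) (Comp D t (i (Dom D t)))
        \<in> Hom D (fobj K (Lo (Dom D t))) (fobj K (Lo (Cod D t)))"
      by (intro HomI) simp_all
    then show ?thesis using full[of "Lo (Dom D t)" "Lo (Cod D t)"] True by auto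
  qed auto
  then obtain La where La: "\<And>t. t \<in> Arr D \<Longrightarrow> La t \<in> Hom C (Lo (Dom D t)) (Lo (Cod D t)) \<and>
      farr K (La t) = Comp D (j (Cod D t)) (Comp D t (i (Dom D t)))"
    by metis
  have La_simps [simp]: "La t \<in> Arr C" "Dom C (La t) = Lo (Dom D t)" "Cod C (La t) = Lo (Cod D t)"
    "farr K (La t) = Comp D (j (Cod D t)) (Comp D t (i (Dom D t)))" if "t \<in> Arr D" for t
    using La[OF that] by (simp_all add: Hom_def)
  define L where "L = \<lparr>fobj = Lo, farr = La\<rparr>"
  have L_simps [simp]: "fobj L = Lo" "farr L = La" by (simp_all add: L_def)
  interpret L: cfunctor D C L
  proof
    \<comment> \<open>Both functor laws hold after applying \<open>K\<close>, where the inverse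
      pairs \<open>i\<close>, \<open>j\<close> cancel; faithfulness removes
      \<open>K\<close>.\<close>
    fix x assume x: "x \<in> Obj D"
    show "farr L (Id D x) = Id C (fobj L x)"
      by (rule faithful[of _ "Lo x" "Lo x"]) (auto simp: x intro!: HomI)
  next
    fix f g x y z assume "f \<in> Hom D x y" "g \<in> Hom D y z"
    note fg [simp] = HomD[OF this(1)] HomD[OF this(2)]
    have [simp]: "x \<in> Obj D" "y \<in> Obj D" "z \<in> Obj D"
      using fg K.target.Dom_Obj K.target.Cod_Obj by metis+
    show "farr L (Comp D g f) = Comp C (farr L g) (farr L f)"
      by (rule faithful[of _ "Lo x" "Lo z"]) (auto simp: ij intro!: HomI)
  qed (auto simp: Hom_def)
  have "nat_iso D D (K \<circ>\<^sub>F L) id_functor i"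
  proof -
    interpret KL: cfunctor D D "K \<circ>\<^sub>F L"
      by (rule cfunctor_comp) unfold_locales
    interpret ID: cfunctor D D id_functor
      by (rule cfunctor_id) unfold_locales
    show ?thesis
    proof
      fix f x y assume "f \<in> Hom D x y"
      note f [simp] = HomD[OF this]
      have [simp]: "x \<in> Obj D" "y \<in> Obj D" using f K.target.Dom_Obj K.target.Cod_Obj by metis+
      show "Comp D (i y) (farr (K \<circ>\<^sub>F L) f) = Comp D (farr id_functor f) (i x)"
        by (simp add: ij)
    qed (auto simp: i iso)
  qed
  moreover have "\<exists>\<phi>. nat_iso C C id_functor (L \<circ>\<^sub>F K) \<phi>"
  proof -
    \<comment> \<open>The other natural isomorphism lifts \<open>j\<close> at \<open>K x\<close> to
      \<open>\<phi> x\<close> and \<open>i\<close> at \<open>K x\<close> to its inverse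
      \<open>\<chi> x\<close>; naturality and the inverse laws again follow from
      faithfulness.\<close>
    have "\<exists>f g. x \<in> Obj C \<longrightarrow> f \<in> Hom C x (Lo (fobj K x)) \<and> farr K f = j (fobj K x) \<and>
        g \<in> Hom C (Lo (fobj K x)) x \<and> farr K g = i (fobj K x)" for x
      using full[of x "Lo (fobj K x)" "j (fobj K x)"] full[of "Lo (fobj K x)" x "i (fobj K x)"]
        j[of "fobj K x"] i[of "fobj K x"]
      by (cases "x \<in> Obj C") auto
    then obtain \<phi> \<chi> where \<phi>\<chi>: "\<And>x. x \<in> Obj C \<Longrightarrow>
        \<phi> x \<in> Hom C x (Lo (fobj K x)) \<and> farr K (\<phi> x) = j (fobj K x) \<and>
        \<chi> x \<in> Hom C (Lo (fobj K x)) x \<and> farr K (\<chi> x) = i (fobj K x)"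
      by metis
    then have [simp]: "\<phi> x \<in> Arr C" "Dom C (\<phi> x) = x" "Cod C (\<phi> x) = Lo (fobj K x)"
      "farr K (\<phi> x) = j (fobj K x)"
      "\<chi> x \<in> Arr C" "Dom C (\<chi> x) = Lo (fobj K x)" "Cod C (\<chi> x) = x"
      "farr K (\<chi> x) = i (fobj K x)" if "x \<in> Obj C" for x
      using that by (auto simp: Hom_def)
    interpret LK: cfunctor C C "L \<circ>\<^sub>F K"
      by (rule cfunctor_comp) unfold_locales
    interpret ID: cfunctor C C id_functor
      by (rule cfunctor_id) unfold_locales
    have "nat_iso C C id_functor (L \<circ>\<^sub>F K) \<phi>"
    proof
      fix f x y assume "f \<in> Hom C x y"
      note f [simp] = HomD[OF this]
      have [simp]: "x \<in> Obj C" "y \<in> Obj C" using f K.source.Dom_Obj K.source.Cod_Obj by metis+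
      show "Comp C (\<phi> y) (farr id_functor f) = Comp C (farr (L \<circ>\<^sub>F K) f) (\<phi> x)"
        by (rule faithful[of _ x "Lo (fobj K y)"]) (auto intro!: HomI)
    next
      fix x assume x [simp]: "x \<in> Obj C"
      have "Comp C (\<chi> x) (\<phi> x) = Id C x"
        by (rule faithful[of _ x x]) (auto intro!: HomI)
      moreover have "Comp C (\<phi> x) (\<chi> x) = Id C (Lo (fobj K x))"
        by (rule faithful[of _ "Lo (fobj K x)" "Lo (fobj K x)"]) (auto intro!: HomI)
      ultimately show "is_iso C (\<phi> x)"
        using \<phi>\<chi>[OF x] K.source.is_isoI by blast
    qed (use \<phi>\<chi> in auto)
    then show ?thesis by blast
  qed
  ultimately show ?thesis
    unfolding is_equivalence_def using K.cfunctor_axioms L.cfunctor_axioms by blast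
qed

section \<open>Algebras of an adjunction\<close>

lemma is_algebra_iff:
  "is_algebra C T \<eta> \<mu> (x, \<alpha>) \<longleftrightarrow>
    x \<in> Obj C \<and> \<alpha> \<in> Arr C \<and> Dom C \<alpha> = fobj T x \<and> Cod C \<alpha> = x \<and>
    Comp C \<alpha> (\<eta> x) = Id C x \<and> Comp C \<alpha> (farr T \<alpha>) = Comp C \<alpha> (\<mu> x)"
  by (auto simp: is_algebra_def Hom_def)

lemma is_coalgebra_iff:
  "is_coalgebra C S \<epsilon> \<delta> (y, \<beta>) \<longleftrightarrow>
    y \<in> Obj C \<and> \<beta> \<in> Arr C \<and> Dom C \<beta> = y \<and> Cod C \<beta> = fobj S y \<and>
    Comp C (\<epsilon> y) \<beta> = Id C y \<and> Comp C (farr S \<beta>) \<beta> = Comp C (\<delta> y) \<beta>"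
  by (auto simp: is_coalgebra_def Hom_def)

lemma is_algebra_hom_iff:
  "is_algebra_hom C T ((x, \<alpha>), f, (y, \<beta>)) \<longleftrightarrow>
    f \<in> Arr C \<and> Dom C f = x \<and> Cod C f = y \<and> Comp C f \<alpha> = Comp C \<beta> (farr T f)"
  by (auto simp: is_algebra_hom_def Hom_def)

lemma is_coalgebra_hom_iff:
  "is_coalgebra_hom C S ((x, \<alpha>), f, (y, \<beta>)) \<longleftrightarrow>
    f \<in> Arr C \<and> Dom C f = x \<and> Cod C f = y \<and> Comp C (farr S f) \<alpha> = Comp C \<beta> f"
  by (auto simp: is_coalgebra_hom_def Hom_def)

context adjunction
begin

sublocale A: category "catA F"
  using ladj_functor by (simp add: cfunctor_def)

sublocale B: category "catB F"
  using ladj_functor by (simp add: cfunctor_def)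

sublocale L: cfunctor "catA F" "catB F" "ladj F"
  by (rule ladj_functor)

sublocale R: cfunctor "catB F" "catA F" "radj F"
  by (rule radj_functor)

abbreviation compA (infixr "\<cdot>\<^sub>A" 70) where "g \<cdot>\<^sub>A f \<equiv> Comp (catA F) g f"
abbreviation compB (infixr "\<cdot>\<^sub>B" 70) where "g \<cdot>\<^sub>B f \<equiv> Comp (catB F) g f"
abbreviation Lo where "Lo \<equiv> fobj (ladj F)"
abbreviation Ro where "Ro \<equiv> fobj (radj F)"
abbreviation L where "L \<equiv> farr (ladj F)"
abbreviation R where "R \<equiv> farr (radj F)"
abbreviation \<eta> where "\<eta> \<equiv> unit\<^sub>\<eta> F"
abbreviation \<epsilon> where "\<epsilon> \<equiv> counit\<^sub>\<epsilon> F"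
abbreviation algebra where
  "algebra \<equiv> is_algebra (catA F) (radj F \<circ>\<^sub>F ladj F) \<eta> (\<lambda>x. R (\<epsilon> (Lo x)))"
abbreviation coalgebra where
  "coalgebra \<equiv> is_coalgebra (catB F) (ladj F \<circ>\<^sub>F radj F) \<epsilon> (\<lambda>y. L (\<eta> (Ro y)))"

lemma unit_simps [simp]:
  assumes "x \<in> Obj (catA F)"
  shows "\<eta> x \<in> Arr (catA F)" "Dom (catA F) (\<eta> x) = x" "Cod (catA F) (\<eta> x) = Ro (Lo x)"
  using nat_trans.component_Hom[OF unit_nat_trans assms] by (simp_all add: Hom_def)

lemma counit_simps [simp]:
  assumes "y \<in> Obj (catB F)"
  shows "\<epsilon> y \<in> Arr (catB F)" "Dom (catB F) (\<epsilon> y) = Lo (Ro y)" "Cod (catB F) (\<epsilon> y) = y"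
  using nat_trans.component_Hom[OF counit_nat_trans assms] by (simp_all add: Hom_def)

lemma unit_natural:
  "f \<in> Arr (catA F) \<Longrightarrow> Cod (catA F) f = y \<Longrightarrow> \<eta> y \<cdot>\<^sub>A f = R (L f) \<cdot>\<^sub>A \<eta> (Dom (catA F) f)"
  using nat_trans.naturality[OF unit_nat_trans, of f "Dom (catA F) f" y] by (simp add: Hom_def)

lemma counit_natural:
  "f \<in> Arr (catB F) \<Longrightarrow> Cod (catB F) f = y \<Longrightarrow> \<epsilon> y \<cdot>\<^sub>B L (R f) = f \<cdot>\<^sub>B \<epsilon> (Dom (catB F) f)"
  using nat_trans.naturality[OF counit_nat_trans, of f "Dom (catB F) f" y] by (simp add: Hom_def)

lemma triangles [simp]:
  "a \<in> Obj (catA F) \<Longrightarrow> \<epsilon> (Lo a) \<cdot>\<^sub>B L (\<eta> a) = Id (catB F) (Lo a)"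
  "b \<in> Obj (catB F) \<Longrightarrow> R (\<epsilon> b) \<cdot>\<^sub>A \<eta> (Ro b) = Id (catA F) (Ro b)"
  by (simp_all add: triangle_ladj triangle_radj)

lemma triangle_radj_Comp [simp]:
  assumes "f \<in> Arr (catA F)" "Cod (catA F) f = Ro b" "b \<in> Obj (catB F)"
  shows "R (\<epsilon> b) \<cdot>\<^sub>A (\<eta> (Ro b) \<cdot>\<^sub>A f) = f"
  using assms by (subst A.Comp_eq[OF triangles(2)]) simp_all

text \<open>An algebra homomorphism \<open>f\<close> is a retract of \<open>R (L f)\<close>, hence determined by \<open>L f\<close>.\<close>

lemma algebra_hom_faithful:
  assumes "algebra (x, \<alpha>)" "algebra (x', \<alpha>')"
    and "is_algebra_hom (catA F) (radj F \<circ>\<^sub>F ladj F) ((x, \<alpha>), f, (x', \<alpha>'))"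
    and "is_algebra_hom (catA F) (radj F \<circ>\<^sub>F ladj F) ((x, \<alpha>), g, (x', \<alpha>'))"
    and "L f = L g"
  shows "f = g"
proof -
  note [simp] = assms[unfolded is_algebra_iff is_algebra_hom_iff comp_functor_simps]
  have "h = \<alpha>' \<cdot>\<^sub>A (R (L h) \<cdot>\<^sub>A \<eta> x)"
    if "is_algebra_hom (catA F) (radj F \<circ>\<^sub>F ladj F) ((x, \<alpha>), h, (x', \<alpha>'))" for h
  proof -
    note h [simp] = that[unfolded is_algebra_iff is_algebra_hom_iff comp_functor_simps]
    have "h = h \<cdot>\<^sub>A (\<alpha> \<cdot>\<^sub>A \<eta> x)" by simp
    also have "\<dots> = (\<alpha>' \<cdot>\<^sub>A R (L h)) \<cdot>\<^sub>A \<eta> x"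
      by (rule A.Comp_eq) simp_all
    also have "\<dots> = \<alpha>' \<cdot>\<^sub>A (R (L h) \<cdot>\<^sub>A \<eta> x)"
      by (rule A.Comp_assoc_Arr) simp_all
    finally show ?thesis .
  qed
  then show ?thesis using assms by metis
qed

text \<open>\<open>e1\<close> says that \<open>h\<close> is an arrow of coalgebras between the
  images under \<open>kappa0\<close>, \<open>e2\<close> that it respects the nucleus algebra
  structures \<open>L \<alpha>\<close> and \<open>L \<alpha>'\<close>. With the unit law of
  \<open>\<alpha>'\<close>, \<open>e1\<close> gives \<open>L f = h\<close>; with its associativity
  law, \<open>e2\<close> makes \<open>f\<close> a homomorphism.\<close>

lemma algebra_hom_full:
  assumes "algebra (x, \<alpha>)" "algebra (x', \<alpha>')"
    and "h \<in> Arr (catB F)" "Dom (catB F) h = Lo x" "Cod (catB F) h = Lo x'"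
    and e1: "L (R h) \<cdot>\<^sub>B L (\<eta> x) = L (\<eta> x') \<cdot>\<^sub>B h"
    and e2: "h \<cdot>\<^sub>B L \<alpha> = L \<alpha>' \<cdot>\<^sub>B L (R h)"
  shows "\<exists>f. is_algebra_hom (catA F) (radj F \<circ>\<^sub>F ladj F) ((x, \<alpha>), f, (x', \<alpha>')) \<and> L f = h"
proof -
  note a = assms(1,2)[unfolded is_algebra_iff comp_functor_simps]
  note [simp] = a assms(3-5)
  have \<alpha>': "\<alpha>' \<cdot>\<^sub>A (R (L \<alpha>') \<cdot>\<^sub>A t) = \<alpha>' \<cdot>\<^sub>A (R (\<epsilon> (Lo x')) \<cdot>\<^sub>A t)"
    if "t \<in> Arr (catA F)" "Cod (catA F) t = Ro (Lo (Ro (Lo x')))" for t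
    by (rule A.Comp_eq_Comp) (simp_all add: that)
  have Re2: "R h \<cdot>\<^sub>A R (L \<alpha>) = R (L \<alpha>') \<cdot>\<^sub>A R (L (R h))"
    using arg_cong[OF e2, of R] by simp
  define f where "f = \<alpha>' \<cdot>\<^sub>A (R h \<cdot>\<^sub>A \<eta> x)"
  have f [simp]: "f \<in> Arr (catA F)" "Dom (catA F) f = x" "Cod (catA F) f = x'"
    by (simp_all add: f_def)
  have "L \<alpha>' \<cdot>\<^sub>B L (\<eta> x') = L (Id (catA F) x')"
    using a(2) by (metis L.farr_Comp_Arr unit_simps comp_functor_simps)
  then have Lf: "L f = h"
    by (simp add: f_def e1 B.Comp_eq[of "L \<alpha>'" "L (\<eta> x')" "L (Id (catA F) x')"])
  have "f \<cdot>\<^sub>A \<alpha> = \<alpha>' \<cdot>\<^sub>A (R h \<cdot>\<^sub>A (R (L \<alpha>) \<cdot>\<^sub>A \<eta> (Ro (Lo x))))"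
    by (simp add: f_def unit_natural)
  also have "\<dots> = \<alpha>' \<cdot>\<^sub>A (R (L \<alpha>') \<cdot>\<^sub>A (R (L (R h)) \<cdot>\<^sub>A \<eta> (Ro (Lo x))))"
    by (subst A.Comp_eq_Comp[OF Re2]) simp_all
  \<comment> \<open>Associativity of \<open>\<alpha>'\<close> trades \<open>R (L \<alpha>')\<close>
    for \<open>R (\<epsilon> (Lo x'))\<close>, and naturality moves the unit to the left of
    \<open>R h\<close>, where a triangle identity cancels the pair.\<close>
  also have "\<dots> = \<alpha>' \<cdot>\<^sub>A (R (\<epsilon> (Lo x')) \<cdot>\<^sub>A (\<eta> (Ro (Lo x')) \<cdot>\<^sub>A R h))"
    by (simp add: \<alpha>' unit_natural)
  also have "\<dots> = \<alpha>' \<cdot>\<^sub>A R h" by simp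
  finally have "f \<cdot>\<^sub>A \<alpha> = \<alpha>' \<cdot>\<^sub>A R (L f)" by (simp add: Lf)
  then show ?thesis
    using Lf f by (intro exI[of _ f]) (simp add: is_algebra_hom_iff)
qed

text \<open>The hypotheses say that \<open>\<theta>\<close> is an algebra on \<open>(y, \<beta>)\<close> for the monad of the nucleus. The algebra \<open>x\<close> splits an idempotent on
  the algebra \<open>R (\<epsilon> y)\<close> and inherits its structure.\<close>

lemma algebra_ess_surj:
  assumes split: "idempotents_split (catA F)"
    and y: "y \<in> Obj (catB F)"
    and \<beta>: "\<beta> \<in> Arr (catB F)" "Dom (catB F) \<beta> = y" "Cod (catB F) \<beta> = Lo (Ro y)"
    and \<theta>: "\<theta> \<in> Arr (catB F)" "Dom (catB F) \<theta> = Lo (Ro y)" "Cod (catB F) \<theta> = y"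
    and \<theta>\<beta>: "\<theta> \<cdot>\<^sub>B \<beta> = Id (catB F) y"
    and \<beta>\<theta>: "L (R \<theta>) \<cdot>\<^sub>B L (\<eta> (Ro y)) = \<beta> \<cdot>\<^sub>B \<theta>"
    and \<theta>\<theta>: "\<theta> \<cdot>\<^sub>B L (R \<theta>) = \<theta> \<cdot>\<^sub>B L (R (\<epsilon> y))"
  shows "\<exists>x \<alpha> i. algebra (x, \<alpha>) \<and>
    i \<in> Arr (catB F) \<and> Dom (catB F) i = Lo x \<and> Cod (catB F) i = y \<and> is_iso (catB F) i \<and>
    L (R i) \<cdot>\<^sub>B L (\<eta> x) = \<beta> \<cdot>\<^sub>B i \<and> i \<cdot>\<^sub>B L \<alpha> = \<theta> \<cdot>\<^sub>B L (R i)"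
proof -
  note [simp] = y \<beta> \<theta>
  define u where "u = R \<theta> \<cdot>\<^sub>A \<eta> (Ro y)"
  have u [simp]: "u \<in> Arr (catA F)" "Dom (catA F) u = Ro y" "Cod (catA F) u = Ro y"
    by (simp_all add: u_def)
  have Lu: "L u = \<beta> \<cdot>\<^sub>B \<theta>" by (simp add: u_def \<beta>\<theta>)
  have \<theta>Lu: "\<theta> \<cdot>\<^sub>B L u = \<theta>" by (simp add: Lu B.Comp_eq[OF \<theta>\<beta>])
  have Lu\<beta>: "L u \<cdot>\<^sub>B \<beta> = \<beta>" by (simp add: Lu \<theta>\<beta>)
  have R\<theta>\<theta>: "R \<theta> \<cdot>\<^sub>A R (L (R \<theta>)) = R \<theta> \<cdot>\<^sub>A R (L (R (\<epsilon> y)))"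
    using arg_cong[OF \<theta>\<theta>, of R] by simp
  \<comment> \<open>Unit naturality moves \<open>R (\<epsilon> y)\<close> and
    \<open>R \<theta>\<close> to the right end of \<open>R \<theta>\<close>, where associativity of
    \<open>\<theta>\<close> equates them. Precomposing with the unit turns the result into
    \<open>u . u = u\<close>, since \<open>R \<theta>\<close> then becomes \<open>u\<close> and
    \<open>R (\<epsilon> y)\<close> becomes the identity.\<close>
  have "u \<cdot>\<^sub>A R (\<epsilon> y) = R \<theta> \<cdot>\<^sub>A (R (L (R (\<epsilon> y))) \<cdot>\<^sub>A \<eta> (Ro (Lo (Ro y))))"
    by (simp add: u_def unit_natural)
  also have "\<dots> = R \<theta> \<cdot>\<^sub>A (R (L (R \<theta>)) \<cdot>\<^sub>A \<eta> (Ro (Lo (Ro y))))"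
    by (subst A.Comp_eq_Comp[OF R\<theta>\<theta>]) simp_all
  also have "\<dots> = u \<cdot>\<^sub>A R \<theta>"
    by (simp add: u_def unit_natural)
  finally have u\<epsilon>: "u \<cdot>\<^sub>A R (\<epsilon> y) = u \<cdot>\<^sub>A R \<theta>" .
  have "u \<cdot>\<^sub>A u = u \<cdot>\<^sub>A (R \<theta> \<cdot>\<^sub>A \<eta> (Ro y))" by (simp add: u_def)
  also have "\<dots> = u \<cdot>\<^sub>A (R (\<epsilon> y) \<cdot>\<^sub>A \<eta> (Ro y))"
    by (subst A.Comp_eq_Comp[OF u\<epsilon>]) simp_all
  also have "\<dots> = u" by simp
  finally have "u \<cdot>\<^sub>A u = u" .
  then obtain x r s where x [simp]: "x \<in> Obj (catA F)"
    and "r \<in> Hom (catA F) (Ro y) x" "s \<in> Hom (catA F) x (Ro y)"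
    and sr: "s \<cdot>\<^sub>A r = u" and rs: "r \<cdot>\<^sub>A s = Id (catA F) x"
    using split y unfolding idempotents_split_def
    by (metis HomI R.functor_simps(1) u)
  note [simp] = HomD[OF \<open>r \<in> Hom (catA F) (Ro y) x\<close>] HomD[OF \<open>s \<in> Hom (catA F) x (Ro y)\<close>]
  have ru: "r \<cdot>\<^sub>A u = r" by (simp add: sr[symmetric] A.Comp_eq[OF rs])
  have us: "u \<cdot>\<^sub>A s = s" by (simp add: sr[symmetric] rs)
  have Lsr: "L s \<cdot>\<^sub>B L r = L u" by (simp add: sr[symmetric])
  have Lrs: "L r \<cdot>\<^sub>B L s = Id (catB F) (Lo x)"
    using arg_cong[OF rs, of L] by simp
  \<comment> \<open>The retraction absorbs \<open>u\<close>, so it too makes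
    \<open>R (\<epsilon> y)\<close> and \<open>R \<theta>\<close> equal.\<close>
  have "r \<cdot>\<^sub>A R (\<epsilon> y) = r \<cdot>\<^sub>A (u \<cdot>\<^sub>A R (\<epsilon> y))"
    by (subst A.Comp_eq[OF ru]) simp_all
  also have "\<dots> = r \<cdot>\<^sub>A R \<theta>"
    unfolding u\<epsilon> by (subst A.Comp_eq[OF ru]) simp_all
  finally have r\<epsilon>: "r \<cdot>\<^sub>A R (\<epsilon> y) = r \<cdot>\<^sub>A R \<theta>" .
  \<comment> \<open>This is the free structure \<open>R (\<epsilon> y)\<close> transported along the
    retract. By \<open>r\<epsilon>\<close> it may equally be written with \<open>\<theta>\<close>:
    the form with \<open>\<epsilon>\<close> serves the unit law and counit naturality, the form with
    \<open>\<theta>\<close> absorbs \<open>L u\<close>.\<close>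
  define \<alpha> where "\<alpha> = r \<cdot>\<^sub>A (R (\<epsilon> y) \<cdot>\<^sub>A R (L s))"
  have \<alpha> [simp]: "\<alpha> \<in> Arr (catA F)" "Dom (catA F) \<alpha> = Ro (Lo x)" "Cod (catA F) \<alpha> = x"
    by (simp_all add: \<alpha>_def)
  have \<alpha>\<theta>: "\<alpha> = r \<cdot>\<^sub>A (R \<theta> \<cdot>\<^sub>A R (L s))"
    unfolding \<alpha>_def by (rule A.Comp_eq_Comp[OF r\<epsilon>]) simp_all
  have "R (L s) \<cdot>\<^sub>A \<eta> x = \<eta> (Ro y) \<cdot>\<^sub>A s"
    by (simp add: unit_natural)
  then have \<alpha>_unit: "\<alpha> \<cdot>\<^sub>A \<eta> x = Id (catA F) x"
    by (simp add: \<alpha>_def rs)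
  have \<alpha>s: "L s \<cdot>\<^sub>B L \<alpha> = L u \<cdot>\<^sub>B (L (R (\<epsilon> y)) \<cdot>\<^sub>B L (R (L s)))"
    by (simp add: \<alpha>_def B.Comp_eq[OF Lsr])
  \<comment> \<open>Associativity: the inner \<open>L s . L r\<close> is \<open>L u\<close>, which
    disappears into \<open>\<theta>\<close>. Then \<open>\<theta>\<close> is changed back to
    \<open>\<epsilon> y\<close>, and counit naturality at \<open>\<epsilon> y . L s\<close>
    finishes.\<close>
  have "\<alpha> \<cdot>\<^sub>A R (L \<alpha>) = r \<cdot>\<^sub>A R (\<theta> \<cdot>\<^sub>B (L s \<cdot>\<^sub>B L \<alpha>))"
    by (simp add: \<alpha>\<theta>)
  also have "\<theta> \<cdot>\<^sub>B (L s \<cdot>\<^sub>B L \<alpha>) = \<theta> \<cdot>\<^sub>B (L (R (\<epsilon> y)) \<cdot>\<^sub>B L (R (L s)))"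
    unfolding \<alpha>s by (simp add: B.Comp_eq[OF \<theta>Lu])
  also have "r \<cdot>\<^sub>A R \<dots> = r \<cdot>\<^sub>A (R \<theta> \<cdot>\<^sub>A R (L (R (\<epsilon> y)) \<cdot>\<^sub>B L (R (L s))))"
    by simp
  also have "\<dots> = r \<cdot>\<^sub>A (R (\<epsilon> y) \<cdot>\<^sub>A R (L (R (\<epsilon> y)) \<cdot>\<^sub>B L (R (L s))))"
    by (rule A.Comp_eq_Comp[OF r\<epsilon>[symmetric]]) simp_all
  also have "\<dots> = r \<cdot>\<^sub>A R (\<epsilon> y \<cdot>\<^sub>B L (R (\<epsilon> y \<cdot>\<^sub>B L s)))"
    by simp
  also have "\<dots> = \<alpha> \<cdot>\<^sub>A R (\<epsilon> (Lo x))"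
    by (subst counit_natural) (simp_all add: \<alpha>_def)
  finally have "algebra (x, \<alpha>)"
    using \<alpha>_unit by (simp add: is_algebra_iff)
  \<comment> \<open>\<open>L u\<close> is split twice, by \<open>L r\<close>, \<open>L s\<close>
    through \<open>Lo x\<close> and by \<open>\<theta>\<close>, \<open>\<beta>\<close> through
    \<open>y\<close>. \<open>i\<close> is the canonical comparison of two splittings of one
    idempotent, with inverse \<open>L r . \<beta>\<close>.\<close>
  moreover define i where "i = \<theta> \<cdot>\<^sub>B L s"
  have i [simp]: "i \<in> Arr (catB F)" "Dom (catB F) i = Lo x" "Cod (catB F) i = y"
    by (simp_all add: i_def)
  moreover have "is_iso (catB F) i"
  proof (rule B.is_isoI[of _ "Lo x" y "L r \<cdot>\<^sub>B \<beta>"])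
    show "(L r \<cdot>\<^sub>B \<beta>) \<cdot>\<^sub>B i = Id (catB F) (Lo x)"
    proof -
      have "(L r \<cdot>\<^sub>B \<beta>) \<cdot>\<^sub>B i = L r \<cdot>\<^sub>B (L u \<cdot>\<^sub>B L s)"
        by (simp add: i_def Lu)
      also have "L u \<cdot>\<^sub>B L s = L s"
        using arg_cong[OF us, of L] by simp
      finally show ?thesis by (simp add: Lrs)
    qed
    show "i \<cdot>\<^sub>B (L r \<cdot>\<^sub>B \<beta>) = Id (catB F) y"
      by (simp add: i_def B.Comp_eq[OF Lsr] Lu\<beta> \<theta>\<beta>)
  qed (auto intro: HomI)
  \<comment> \<open>This equation makes \<open>i\<close> a coalgebra homomorphism from the image of
    \<open>x\<close> under \<open>kappa0\<close> to \<open>(y, \<beta>)\<close>; the next one makes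
    it compatible with the nucleus algebra structures \<open>L \<alpha>\<close> and
    \<open>\<theta>\<close>.\<close>
  moreover have "L (R i) \<cdot>\<^sub>B L (\<eta> x) = \<beta> \<cdot>\<^sub>B i"
  proof -
    have "R (L s) \<cdot>\<^sub>A \<eta> x = \<eta> (Ro y) \<cdot>\<^sub>A s"
      by (simp add: unit_natural)
    from arg_cong[OF this, of L]
    have "L (R i) \<cdot>\<^sub>B L (\<eta> x) = L (R \<theta>) \<cdot>\<^sub>B (L (\<eta> (Ro y)) \<cdot>\<^sub>B L s)"
      by (simp add: i_def)
    also have "\<dots> = \<beta> \<cdot>\<^sub>B i"
      unfolding i_def by (rule B.Comp_eq_Comp[OF \<beta>\<theta>]) simp_all
    finally show ?thesis .
  qed
  moreover have "i \<cdot>\<^sub>B L \<alpha> = \<theta> \<cdot>\<^sub>B L (R i)"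
  proof -
    have "i \<cdot>\<^sub>B L \<alpha> = \<theta> \<cdot>\<^sub>B (L s \<cdot>\<^sub>B L \<alpha>)" by (simp add: i_def)
    also have "\<dots> = \<theta> \<cdot>\<^sub>B (L (R (\<epsilon> y)) \<cdot>\<^sub>B L (R (L s)))"
      unfolding \<alpha>s by (simp add: B.Comp_eq[OF \<theta>Lu])
    also have "\<dots> = \<theta> \<cdot>\<^sub>B (L (R \<theta>) \<cdot>\<^sub>B L (R (L s)))"
      by (rule B.Comp_eq_Comp[OF \<theta>\<theta>[symmetric]]) simp_all
    finally show ?thesis by (simp add: i_def)
  qed
  ultimately show ?thesis by blast
qed

end

section \<open>Duality\<close>

text \<open>Reversing arrows leaves the record of a functor unchanged, and algebras of a dual are literally
  coalgebras; only the triples that are arrows of \<open>Alg\<close> and \<open>Coalg\<close> get reversed.\<close>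

definition op_cat :: "('o, 'm) category \<Rightarrow> ('o, 'm) category" where
  "op_cat C = \<lparr>Obj = Obj C, Arr = Arr C, Dom = Cod C, Cod = Dom C, Id = Id C,
    Comp = (\<lambda>g f. Comp C f g)\<rparr>"

lemma op_cat_simps [simp]:
  "Obj (op_cat C) = Obj C" "Arr (op_cat C) = Arr C" "Dom (op_cat C) = Cod C"
  "Cod (op_cat C) = Dom C" "Id (op_cat C) = Id C" "Comp (op_cat C) g f = Comp C f g"
  "Hom (op_cat C) x y = Hom C y x"
  by (auto simp: op_cat_def Hom_def)

definition op_adj :: "('oa, 'ma, 'ob, 'mb) adjunction \<Rightarrow> ('ob, 'mb, 'oa, 'ma) adjunction" where
  "op_adj F = \<lparr>catA = op_cat (catB F), catB = op_cat (catA F), ladj = radj F, radj = ladj F,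
    unit\<^sub>\<eta> = counit\<^sub>\<epsilon> F, counit\<^sub>\<epsilon> = unit\<^sub>\<eta> F\<rparr>"

lemma op_adj_simps [simp]:
  "catA (op_adj F) = op_cat (catB F)" "catB (op_adj F) = op_cat (catA F)"
  "ladj (op_adj F) = radj F" "radj (op_adj F) = ladj F"
  "unit\<^sub>\<eta> (op_adj F) = counit\<^sub>\<epsilon> F" "counit\<^sub>\<epsilon> (op_adj F) = unit\<^sub>\<eta> F"
  by (simp_all add: op_adj_def)

lemma (in category) category_op: "category (op_cat C)"
  by unfold_locales (auto simp: Hom_def)

lemma cfunctor_op: "cfunctor C D F \<Longrightarrow> cfunctor (op_cat C) (op_cat D) F"
  by (simp add: cfunctor_def cfunctor_axioms_def category.category_op) blast

lemma nat_trans_op: "nat_trans C D F G \<tau> \<Longrightarrow> nat_trans (op_cat C) (op_cat D) G F \<tau>"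
  by (auto simp: nat_trans_def nat_trans_axioms_def cfunctor_op)

lemma adjunction_op: "adjunction F \<Longrightarrow> adjunction (op_adj F)"
  by (simp add: adjunction_def cfunctor_op nat_trans_op)

lemma idempotents_split_op: "idempotents_split C \<Longrightarrow> idempotents_split (op_cat C)"
  unfolding idempotents_split_def op_cat_simps by metis

lemma is_iso_op [simp]: "is_iso (op_cat C) f \<longleftrightarrow> is_iso C f"
  by (auto simp: is_iso_def)

lemma is_algebra_op [simp]: "is_algebra (op_cat C) T \<eta> \<mu> = is_coalgebra C T \<eta> \<mu>"
  by (simp add: is_algebra_def is_coalgebra_def)

lemma is_algebra_hom_op [simp]:
  "is_algebra_hom (op_cat C) T (a, f, b) \<longleftrightarrow> is_coalgebra_hom C T (b, f, a)"
  by (auto simp: is_algebra_hom_def is_coalgebra_hom_def split: prod.split)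

section \<open>Coalgebra statements obtained from the dual adjunction\<close>

context adjunction
begin

lemma coalgebra_hom_faithful:
  assumes "coalgebra (y, \<beta>)" "coalgebra (y', \<beta>')"
    and "is_coalgebra_hom (catB F) (ladj F \<circ>\<^sub>F radj F) ((y, \<beta>), f, (y', \<beta>'))"
    and "is_coalgebra_hom (catB F) (ladj F \<circ>\<^sub>F radj F) ((y, \<beta>), g, (y', \<beta>'))"
    and "R f = R g"
  shows "f = g"
  using adjunction.algebra_hom_faithful[OF adjunction_op[OF adjunction_axioms], of y' \<beta>' y \<beta> f g]
    assms by simp

lemma coalgebra_hom_full:
  assumes "coalgebra (y, \<beta>)" "coalgebra (y', \<beta>')"
    and "h \<in> Arr (catA F)" "Dom (catA F) h = Ro y" "Cod (catA F) h = Ro y'"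
    and "h \<cdot>\<^sub>A R (\<epsilon> y) = R (\<epsilon> y') \<cdot>\<^sub>A R (L h)"
    and "R (L h) \<cdot>\<^sub>A R \<beta> = R \<beta>' \<cdot>\<^sub>A h"
  shows "\<exists>f. is_coalgebra_hom (catB F) (ladj F \<circ>\<^sub>F radj F) ((y, \<beta>), f, (y', \<beta>')) \<and> R f = h"
  using adjunction.algebra_hom_full[OF adjunction_op[OF adjunction_axioms], of y' \<beta>' y \<beta> h]
    assms by simp

text \<open>Here \<open>\<theta>\<close> is a coalgebra structure on the algebra
  \<open>(x, \<alpha>)\<close> for the comonad of the nucleus, whose counit is
  \<open>\<alpha>\<close> and whose comultiplication is \<open>R (L (\<eta> x))\<close>. The
  idempotent to be split now lives in \<open>catB F\<close>, and the isomorphism points from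
  \<open>x\<close> to \<open>Ro y\<close>.\<close>

lemma coalgebra_ess_surj:
  assumes "idempotents_split (catB F)"
    and "x \<in> Obj (catA F)"
    and "\<alpha> \<in> Arr (catA F)" "Dom (catA F) \<alpha> = Ro (Lo x)" "Cod (catA F) \<alpha> = x"
    and "\<theta> \<in> Arr (catA F)" "Dom (catA F) \<theta> = x" "Cod (catA F) \<theta> = Ro (Lo x)"
    and "\<alpha> \<cdot>\<^sub>A \<theta> = Id (catA F) x"
    and "R (\<epsilon> (Lo x)) \<cdot>\<^sub>A R (L \<theta>) = \<theta> \<cdot>\<^sub>A \<alpha>"
    and "R (L \<theta>) \<cdot>\<^sub>A \<theta> = R (L (\<eta> x)) \<cdot>\<^sub>A \<theta>"
  shows "\<exists>y \<beta> i. coalgebra (y, \<beta>) \<and>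
    i \<in> Arr (catA F) \<and> Dom (catA F) i = x \<and> Cod (catA F) i = Ro y \<and> is_iso (catA F) i \<and>
    R (\<epsilon> y) \<cdot>\<^sub>A R (L i) = i \<cdot>\<^sub>A \<alpha> \<and> R \<beta> \<cdot>\<^sub>A i = R (L i) \<cdot>\<^sub>A \<theta>"
  using adjunction.algebra_ess_surj
    [OF adjunction_op[OF adjunction_axioms], of x \<alpha> \<theta>] assms
  by (simp add: idempotents_split_op) blast

end

section \<open>Eilenberg--Moore categories and the nucleus\<close>

lemma structured_cat_simps [simp]:
  "Obj (structured_cat C X P) = X"
  "(a, f, b) \<in> Arr (structured_cat C X P) \<longleftrightarrow> a \<in> X \<and> b \<in> X \<and> P (a, f, b)"
  "Dom (structured_cat C X P) (a, f, b) = a"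
  "Cod (structured_cat C X P) (a, f, b) = b"
  "Id (structured_cat C X P) a = (a, Id C (fst a), a)"
  "Comp (structured_cat C X P) (b, g, c) (a, f, b') = (a, Comp C g f, c)"
  by (simp_all add: structured_cat_def)

lemma (in category) category_structured_cat:
  assumes X: "\<And>a. a \<in> X \<Longrightarrow> fst a \<in> Obj C"
    and P: "\<And>a f b. P (a, f, b) \<Longrightarrow> f \<in> Hom C (fst a) (fst b)"
    and P_Id: "\<And>a. a \<in> X \<Longrightarrow> P (a, Id C (fst a), a)"
    and P_Comp: "\<And>a f b g c. a \<in> X \<Longrightarrow> b \<in> X \<Longrightarrow> c \<in> X \<Longrightarrow> P (a, f, b) \<Longrightarrow> P (b, g, c) \<Longrightarrow>
      P (a, Comp C g f, c)"
  shows "category (structured_cat C X P)"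
proof
  fix f x y assume "f \<in> Hom (structured_cat C X P) x y"
  then show "Comp (structured_cat C X P) f (Id (structured_cat C X P) x) = f"
    "Comp (structured_cat C X P) (Id (structured_cat C X P) y) f = f"
    by (cases f; auto simp: Hom_def dest!: P)+
next
  fix f g h w x y z
  assume "f \<in> Hom (structured_cat C X P) w x" "g \<in> Hom (structured_cat C X P) x y"
    "h \<in> Hom (structured_cat C X P) y z"
  then show "Comp (structured_cat C X P) h (Comp (structured_cat C X P) g f) =
      Comp (structured_cat C X P) (Comp (structured_cat C X P) h g) f"
    by (cases f; cases g; cases h; auto simp: Hom_def dest!: P)
next
  fix f g x y z
  assume "f \<in> Hom (structured_cat C X P) x y" "g \<in> Hom (structured_cat C X P) y z"
  then show "Comp (structured_cat C X P) g f \<in> Hom (structured_cat C X P) x z"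
    by (cases f; cases g; auto simp: Hom_def intro: P_Comp)
qed (auto simp: Hom_def P_Id)

lemma Alg_simps [simp]:
  "a \<in> Obj (Alg F) \<longleftrightarrow> is_algebra (catA F) (radj F \<circ>\<^sub>F ladj F) (unit\<^sub>\<eta> F)
    (\<lambda>x. farr (radj F) (counit\<^sub>\<epsilon> F (fobj (ladj F) x))) a"
  "(a, f, b) \<in> Arr (Alg F) \<longleftrightarrow> a \<in> Obj (Alg F) \<and> b \<in> Obj (Alg F) \<and>
    is_algebra_hom (catA F) (radj F \<circ>\<^sub>F ladj F) (a, f, b)"
  "Dom (Alg F) (a, f, b) = a"
  "Cod (Alg F) (a, f, b) = b"
  "Id (Alg F) a = (a, Id (catA F) (fst a), a)"
  "Comp (Alg F) (b, g, c) (a, f, b') = (a, Comp (catA F) g f, c)"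
  by (simp_all add: Alg_def)

lemma Coalg_simps [simp]:
  "b \<in> Obj (Coalg F) \<longleftrightarrow> is_coalgebra (catB F) (ladj F \<circ>\<^sub>F radj F) (counit\<^sub>\<epsilon> F)
    (\<lambda>y. farr (ladj F) (unit\<^sub>\<eta> F (fobj (radj F) y))) b"
  "(a, f, b) \<in> Arr (Coalg F) \<longleftrightarrow> a \<in> Obj (Coalg F) \<and> b \<in> Obj (Coalg F) \<and>
    is_coalgebra_hom (catB F) (ladj F \<circ>\<^sub>F radj F) (a, f, b)"
  "Dom (Coalg F) (a, f, b) = a"
  "Cod (Coalg F) (a, f, b) = b"
  "Id (Coalg F) a = (a, Id (catB F) (fst a), a)"
  "Comp (Coalg F) (b, g, c) (a, f, b') = (a, Comp (catB F) g f, c)"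
  by (simp_all add: Coalg_def)

lemma forget_simps [simp]: "fobj forget a = fst a" "farr forget (a, f, b) = f"
  by (simp_all add: forget_def)

lemma kappa_simps [simp]:
  "fobj (kappa0 F) x = (fobj (ladj F) x, farr (ladj F) (unit\<^sub>\<eta> F x))"
  "farr (kappa0 F) f =
    (fobj (kappa0 F) (Dom (catA F) f), farr (ladj F) f, fobj (kappa0 F) (Cod (catA F) f))"
  "fobj (kappa1 F) y = (fobj (radj F) y, farr (radj F) (counit\<^sub>\<epsilon> F y))"
  "farr (kappa1 F) g =
    (fobj (kappa1 F) (Dom (catB F) g), farr (radj F) g, fobj (kappa1 F) (Cod (catB F) g))"
  by (simp_all add: kappa0_def kappa1_def kappa0_obj_def kappa1_obj_def)

lemma Nuc_simps [simp]:
  "catA (Nuc F) = Coalg F" "catB (Nuc F) = Alg F"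
  "ladj (Nuc F) = kappa1 F \<circ>\<^sub>F forget" "radj (Nuc F) = kappa0 F \<circ>\<^sub>F forget"
  "unit\<^sub>\<eta> (Nuc F) (y, \<beta>) =
    ((y, \<beta>), \<beta>, (fobj (ladj F) (fobj (radj F) y), farr (ladj F) (unit\<^sub>\<eta> F (fobj (radj F) y))))"
  "counit\<^sub>\<epsilon> (Nuc F) (x, \<alpha>) =
    ((fobj (radj F) (fobj (ladj F) x), farr (radj F) (counit\<^sub>\<epsilon> F (fobj (ladj F) x))), \<alpha>, (x, \<alpha>))"
  by (simp_all add: Nuc_def upper_sharp_def lower_sharp_def)

section \<open>The categories \<open>Alg F\<close> and \<open>Coalg F\<close>, the comparison
  functors, and the adjunction \<open>Nuc F\<close>\<close>

context adjunction
begin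

lemma algebra_hom_Comp:
  assumes "algebra a" "algebra b" "algebra c"
    and "is_algebra_hom (catA F) (radj F \<circ>\<^sub>F ladj F) (a, f, b)"
    and "is_algebra_hom (catA F) (radj F \<circ>\<^sub>F ladj F) (b, g, c)"
  shows "is_algebra_hom (catA F) (radj F \<circ>\<^sub>F ladj F) (a, g \<cdot>\<^sub>A f, c)"
proof -
  obtain x \<alpha> y \<beta> z \<gamma> where abc: "a = (x, \<alpha>)" "b = (y, \<beta>)" "c = (z, \<gamma>)"
    by (metis surj_pair)
  note [simp] = assms(1-3)[unfolded is_algebra_iff abc comp_functor_simps]
  note f = assms(4)[unfolded is_algebra_hom_iff abc comp_functor_simps]
  note g = assms(5)[unfolded is_algebra_hom_iff abc comp_functor_simps]
  have [simp]: "f \<in> Arr (catA F)" "Dom (catA F) f = x" "Cod (catA F) f = y"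
    "g \<in> Arr (catA F)" "Dom (catA F) g = y" "Cod (catA F) g = z"
    using f g by simp_all
  have "(g \<cdot>\<^sub>A f) \<cdot>\<^sub>A \<alpha> = g \<cdot>\<^sub>A (\<beta> \<cdot>\<^sub>A R (L f))" using f by simp
  also have "\<dots> = \<gamma> \<cdot>\<^sub>A (R (L g) \<cdot>\<^sub>A R (L f))"
    by (rule A.Comp_eq_Comp) (use g in simp_all)
  finally show ?thesis by (simp add: abc is_algebra_hom_iff)
qed

lemma coalgebra_hom_Comp:
  assumes "coalgebra a" "coalgebra b" "coalgebra c"
    and "is_coalgebra_hom (catB F) (ladj F \<circ>\<^sub>F radj F) (a, f, b)"
    and "is_coalgebra_hom (catB F) (ladj F \<circ>\<^sub>F radj F) (b, g, c)"
  shows "is_coalgebra_hom (catB F) (ladj F \<circ>\<^sub>F radj F) (a, g \<cdot>\<^sub>B f, c)"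
  using adjunction.algebra_hom_Comp[OF adjunction_op[OF adjunction_axioms], of c b a g f] assms
  by simp

lemma category_Alg: "category (Alg F)"
  unfolding Alg_def
proof (rule A.category_structured_cat, goal_cases)
  case (4 a f b g c)
  then show ?case using algebra_hom_Comp by simp
qed (safe, auto simp: is_algebra_iff is_algebra_hom_iff intro: HomI)

lemma category_Coalg: "category (Coalg F)"
  unfolding Coalg_def
proof (rule B.category_structured_cat, goal_cases)
  case (4 a f b g c)
  then show ?case using coalgebra_hom_Comp by simp
qed (safe, auto simp: is_coalgebra_iff is_coalgebra_hom_iff intro: HomI)

lemma cfunctor_forget_Alg: "cfunctor (Alg F) (catA F) forget"
proof -
  interpret C: category "Alg F" by (rule category_Alg)
  show ?thesis
    by unfold_locales (auto simp: Hom_def is_algebra_iff is_algebra_hom_iff)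
qed

lemma cfunctor_forget_Coalg: "cfunctor (Coalg F) (catB F) forget"
proof -
  interpret C: category "Coalg F" by (rule category_Coalg)
  show ?thesis
    by unfold_locales (auto simp: Hom_def is_coalgebra_iff is_coalgebra_hom_iff)
qed

lemma algebra_kappa1:
  assumes "y \<in> Obj (catB F)"
  shows "algebra (Ro y, R (\<epsilon> y))"
proof -
  \<comment> \<open>Associativity of the free structure is counit naturality at the arrow
    \<open>\<epsilon> y\<close> itself.\<close>
  have "R (\<epsilon> y \<cdot>\<^sub>B L (R (\<epsilon> y))) = R (\<epsilon> y \<cdot>\<^sub>B \<epsilon> (Lo (Ro y)))"
    using assms by (simp only: counit_natural counit_simps)
  then show ?thesis
    using assms by (simp add: is_algebra_iff)
qed

lemma coalgebra_kappa0:
  assumes "x \<in> Obj (catA F)"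
  shows "coalgebra (Lo x, L (\<eta> x))"
  using adjunction.algebra_kappa1[OF adjunction_op[OF adjunction_axioms], of x] assms by simp

lemma cfunctor_kappa1: "cfunctor (catB F) (Alg F) (kappa1 F)"
proof -
  interpret C: category "Alg F" by (rule category_Alg)
  have *: "R f \<cdot>\<^sub>A R (\<epsilon> (Dom (catB F) f)) = R (\<epsilon> (Cod (catB F) f)) \<cdot>\<^sub>A R (L (R f))"
    if "f \<in> Arr (catB F)" for f
    using arg_cong[OF counit_natural[OF that refl], of R] that by simp
  show ?thesis
    by unfold_locales (auto simp: Hom_def is_algebra_hom_iff algebra_kappa1 *)
qed

lemma cfunctor_kappa0: "cfunctor (catA F) (Coalg F) (kappa0 F)"
proof -
  interpret C: category "Coalg F" by (rule category_Coalg)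
  have *: "L (R (L f)) \<cdot>\<^sub>B L (\<eta> (Dom (catA F) f)) = L (\<eta> (Cod (catA F) f)) \<cdot>\<^sub>B L f"
    if "f \<in> Arr (catA F)" for f
    using arg_cong[OF unit_natural[OF that refl], of L] that by simp
  show ?thesis
    by unfold_locales (auto simp: Hom_def is_coalgebra_hom_iff coalgebra_kappa0 *)
qed

text \<open>Every law is already part of the Eilenberg-Moore data. Coassociativity of
  \<open>\<beta>\<close> makes the unit component a coalgebra homomorphism, associativity of
  \<open>\<alpha>\<close> makes the counit component an algebra homomorphism, and naturality of
  either is the homomorphism condition. The triangles are \<open>R\<close> of the counit law of
  \<open>\<beta>\<close> and \<open>L\<close> of the unit law of \<open>\<alpha>\<close>.\<close>

lemma adjunction_Nuc: "adjunction (Nuc F)"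
proof -
  interpret Al: category "Alg F" by (rule category_Alg)
  interpret Co: category "Coalg F" by (rule category_Coalg)
  interpret U: cfunctor "Coalg F" "Alg F" "kappa1 F \<circ>\<^sub>F forget"
    by (rule cfunctor_comp[OF cfunctor_forget_Coalg cfunctor_kappa1])
  interpret V: cfunctor "Alg F" "Coalg F" "kappa0 F \<circ>\<^sub>F forget"
    by (rule cfunctor_comp[OF cfunctor_forget_Alg cfunctor_kappa0])
  interpret VU: cfunctor "Coalg F" "Coalg F" "(kappa0 F \<circ>\<^sub>F forget) \<circ>\<^sub>F (kappa1 F \<circ>\<^sub>F forget)"
    by (rule cfunctor_comp) unfold_locales
  interpret UV: cfunctor "Alg F" "Alg F" "(kappa1 F \<circ>\<^sub>F forget) \<circ>\<^sub>F (kappa0 F \<circ>\<^sub>F forget)"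
    by (rule cfunctor_comp) unfold_locales
  interpret IA: cfunctor "Alg F" "Alg F" id_functor
    by (rule cfunctor_id) unfold_locales
  interpret IC: cfunctor "Coalg F" "Coalg F" id_functor
    by (rule cfunctor_id) unfold_locales
  have "nat_trans (Coalg F) (Coalg F) id_functor
      ((kappa0 F \<circ>\<^sub>F forget) \<circ>\<^sub>F (kappa1 F \<circ>\<^sub>F forget)) (unit\<^sub>\<eta> (Nuc F))"
  proof
    fix b assume "b \<in> Obj (Coalg F)"
    moreover obtain y \<beta> where b: "b = (y, \<beta>)" by fastforce
    ultimately have c: "coalgebra (y, \<beta>)" by simp
    then show "unit\<^sub>\<eta> (Nuc F) b \<in> Hom (Coalg F) (fobj id_functor b)
        (fobj ((kappa0 F \<circ>\<^sub>F forget) \<circ>\<^sub>F (kappa1 F \<circ>\<^sub>F forget)) b)"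
      using c[unfolded is_coalgebra_iff]
      by (simp add: b Hom_def is_coalgebra_hom_iff coalgebra_kappa0)
  next
    fix t b b' assume t: "t \<in> Hom (Coalg F) b b'"
    obtain y \<beta> y' \<beta>' where b: "b = (y, \<beta>)" "b' = (y', \<beta>')" by (metis surj_pair)
    obtain f where f: "t = (b, f, b')" using t by (cases t) (simp add: Hom_def)
    show "Comp (Coalg F) (unit\<^sub>\<eta> (Nuc F) b') (farr id_functor t) =
      Comp (Coalg F) (farr ((kappa0 F \<circ>\<^sub>F forget) \<circ>\<^sub>F (kappa1 F \<circ>\<^sub>F forget)) t)
        (unit\<^sub>\<eta> (Nuc F) b)"
      using t by (simp add: b f Hom_def is_coalgebra_hom_iff)
  qed
  moreover have "nat_trans (Alg F) (Alg F)
      ((kappa1 F \<circ>\<^sub>F forget) \<circ>\<^sub>F (kappa0 F \<circ>\<^sub>F forget)) id_functor (counit\<^sub>\<epsilon> (Nuc F))"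
  proof
    fix a assume "a \<in> Obj (Alg F)"
    moreover obtain x \<alpha> where a: "a = (x, \<alpha>)" by fastforce
    ultimately have c: "algebra (x, \<alpha>)" by simp
    then show "counit\<^sub>\<epsilon> (Nuc F) a \<in> Hom (Alg F)
        (fobj ((kappa1 F \<circ>\<^sub>F forget) \<circ>\<^sub>F (kappa0 F \<circ>\<^sub>F forget)) a) (fobj id_functor a)"
      using c[unfolded is_algebra_iff]
      by (simp add: a Hom_def is_algebra_hom_iff algebra_kappa1)
  next
    fix t a a' assume t: "t \<in> Hom (Alg F) a a'"
    obtain x \<alpha> x' \<alpha>' where a: "a = (x, \<alpha>)" "a' = (x', \<alpha>')" by (metis surj_pair)
    obtain f where f: "t = (a, f, a')" using t by (cases t) (simp add: Hom_def)
    show "Comp (Alg F) (counit\<^sub>\<epsilon> (Nuc F) a')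
        (farr ((kappa1 F \<circ>\<^sub>F forget) \<circ>\<^sub>F (kappa0 F \<circ>\<^sub>F forget)) t) =
      Comp (Alg F) (farr id_functor t) (counit\<^sub>\<epsilon> (Nuc F) a)"
      using t by (simp add: a f Hom_def is_algebra_hom_iff)
  qed
  moreover have "R (\<epsilon> y) \<cdot>\<^sub>A R \<beta> = Id (catA F) (Ro y)" if "coalgebra (y, \<beta>)" for y \<beta>
    using that by (simp add: is_coalgebra_iff R.farr_Comp_Arr[symmetric])
  moreover have "L \<alpha> \<cdot>\<^sub>B L (\<eta> x) = Id (catB F) (Lo x)" if "algebra (x, \<alpha>)" for x \<alpha>
    using that by (simp add: is_algebra_iff L.farr_Comp_Arr[symmetric])
  ultimately show ?thesis
    using U.cfunctor_axioms V.cfunctor_axioms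
    by (intro adjunction.intro) (auto simp: is_coalgebra_iff is_algebra_iff)
qed

section \<open>Reflection of isomorphisms, and the comparison functors of the nucleus\<close>

lemma is_iso_Alg:
  assumes "(a, f, b) \<in> Arr (Alg F)" "is_iso (catA F) f"
  shows "is_iso (Alg F) (a, f, b)"
proof -
  interpret C: category "Alg F" by (rule category_Alg)
  obtain x \<alpha> y \<beta> where ab: "a = (x, \<alpha>)" "b = (y, \<beta>)"
    by (metis surj_pair)
  note f = assms(1)[unfolded ab Alg_simps is_algebra_iff is_algebra_hom_iff comp_functor_simps]
  note [simp] = f
  obtain g where "g \<in> Hom (catA F) y x" and gf: "g \<cdot>\<^sub>A f = Id (catA F) x"
    and fg: "f \<cdot>\<^sub>A g = Id (catA F) y"
    using A.is_isoE[OF assms(2) HomI, of x y] f by blast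
  note [simp] = HomD[OF this(1)]
  have "R (L f) \<cdot>\<^sub>A R (L g) = R (L (f \<cdot>\<^sub>A g))" by simp
  also have "\<dots> = Id (catA F) (Ro (Lo y))" by (simp add: fg)
  finally have RLfg: "R (L f) \<cdot>\<^sub>A R (L g) = Id (catA F) (Ro (Lo y))" .
  \<comment> \<open>The inverse is automatically a homomorphism: insert
    \<open>R (L f) . R (L g)\<close>, pull \<open>f\<close> to the front by its homomorphism law,
    and cancel it against \<open>g\<close>.\<close>
  have "g \<cdot>\<^sub>A \<beta> = g \<cdot>\<^sub>A (\<beta> \<cdot>\<^sub>A (R (L f) \<cdot>\<^sub>A R (L g)))"
    by (simp add: RLfg)
  also have "\<beta> \<cdot>\<^sub>A (R (L f) \<cdot>\<^sub>A R (L g)) = f \<cdot>\<^sub>A (\<alpha> \<cdot>\<^sub>A R (L g))"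
    by (rule A.Comp_eq_Comp) simp_all
  also have "g \<cdot>\<^sub>A (f \<cdot>\<^sub>A (\<alpha> \<cdot>\<^sub>A R (L g))) = \<alpha> \<cdot>\<^sub>A R (L g)"
    by (subst A.Comp_eq[OF gf]) simp_all
  finally have "(b, g, a) \<in> Arr (Alg F)"
    using assms(1) by (simp add: ab is_algebra_hom_iff)
  then show ?thesis
    using assms(1) by (intro C.is_isoI[of _ a b "(b, g, a)"]) (auto simp: Hom_def ab gf fg)
qed

lemma is_iso_Coalg:
  assumes "(a, f, b) \<in> Arr (Coalg F)" "is_iso (catB F) f"
  shows "is_iso (Coalg F) (a, f, b)"
proof -
  interpret D: adjunction "op_adj F" by (rule adjunction_op[OF adjunction_axioms])
  interpret C: category "Coalg F" by (rule category_Coalg)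
  have "is_iso (Alg (op_adj F)) (b, f, a)"
    using D.is_iso_Alg[of b f a] assms by simp
  then obtain g where g: "g \<in> Arr (Alg (op_adj F))"
      "Dom (Alg (op_adj F)) g = a" "Cod (Alg (op_adj F)) g = b"
      "Comp (Alg (op_adj F)) g (b, f, a) = Id (Alg (op_adj F)) b"
      "Comp (Alg (op_adj F)) (b, f, a) g = Id (Alg (op_adj F)) a"
    by (auto simp: is_iso_def Hom_def)
  \<comment> \<open>The inverse found in the dual is a triple with its ends reversed, so its middle
    component is extracted and repackaged.\<close>
  obtain g' where "g = (a, g', b)" using g(2,3) by (cases g) auto
  then show ?thesis
    using assms(1) g by (intro C.is_isoI[of _ a b "(b, g', a)"]) (auto simp: Hom_def)
qed

text \<open>The functor \<open>kappa1 (Nuc F)\<close> takes \<open>(x, \<alpha>)\<close> to the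
  coalgebra on \<open>Lo x\<close> with nucleus structure \<open>L \<alpha>\<close>, and acts on
  arrows by \<open>L\<close>. The three premises of \<open>is_equivalenceI\<close> therefore reduce
  to the three algebra lemmas about \<open>L\<close>.\<close>

lemma monadic_Nuc:
  assumes "idempotents_split (catA F)"
  shows "monadic (Nuc F)"
proof -
  interpret N: adjunction "Nuc F" by (rule adjunction_Nuc)
  have "is_equivalence (Alg F) (Alg (Nuc F)) (kappa1 (Nuc F))"
  proof (rule is_equivalenceI)
    show "cfunctor (Alg F) (Alg (Nuc F)) (kappa1 (Nuc F))"
      using N.cfunctor_kappa1 by simp
  next
    fix a b s t
    assume s: "s \<in> Hom (Alg F) a b" and t: "t \<in> Hom (Alg F) a b"
      and eq: "farr (kappa1 (Nuc F)) s = farr (kappa1 (Nuc F)) t"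
    obtain x \<alpha> y \<beta> where ab: "a = (x, \<alpha>)" "b = (y, \<beta>)"
      by (metis surj_pair)
    obtain f g where fg: "s = (a, f, b)" "t = (a, g, b)"
      using s t by (cases s; cases t) (simp add: Hom_def)
    have "f = g"
    proof (rule algebra_hom_faithful)
      show "L f = L g" using eq by (simp add: fg)
    qed (use s t in \<open>simp_all add: Hom_def ab fg\<close>)
    then show "s = t" by (simp add: fg)
  next
    fix a b t
    assume ab: "a \<in> Obj (Alg F)" "b \<in> Obj (Alg F)"
      and t: "t \<in> Hom (Alg (Nuc F)) (fobj (kappa1 (Nuc F)) a) (fobj (kappa1 (Nuc F)) b)"
    obtain x \<alpha> y \<beta> where ab_eq: "a = (x, \<alpha>)" "b = (y, \<beta>)"
      by (metis surj_pair)
    have alg: "algebra (x, \<alpha>)" "algebra (y, \<beta>)" using ab by (simp_all add: ab_eq)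
    note alg' = alg[unfolded is_algebra_iff comp_functor_simps]
    obtain t' where t': "t = (fobj (kappa1 (Nuc F)) a, t', fobj (kappa1 (Nuc F)) b)"
      using t by (cases t) (simp add: Hom_def)
    have hom: "is_algebra_hom (Coalg F) (radj (Nuc F) \<circ>\<^sub>F ladj (Nuc F))
        (fobj (kappa1 (Nuc F)) a, t', fobj (kappa1 (Nuc F)) b)"
      using t unfolding t' Hom_def by simp
    obtain h where h: "t' = ((Lo x, L (\<eta> x)), h, (Lo y, L (\<eta> y)))"
      using hom by (cases t') (simp add: is_algebra_hom_iff ab_eq)
    have h_hom: "h \<in> Arr (catB F)" "Dom (catB F) h = Lo x" "Cod (catB F) h = Lo y"
      "L (R h) \<cdot>\<^sub>B L (\<eta> x) = L (\<eta> y) \<cdot>\<^sub>B h"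
      using hom by (simp_all add: is_algebra_hom_iff ab_eq h is_coalgebra_hom_iff)
    moreover have "h \<cdot>\<^sub>B L \<alpha> = L \<beta> \<cdot>\<^sub>B L (R h)"
      using hom alg' h_hom by (simp add: is_algebra_hom_iff ab_eq h)
    ultimately obtain f where f: "is_algebra_hom (catA F) (radj F \<circ>\<^sub>F ladj F) ((x, \<alpha>), f, (y, \<beta>))"
      "L f = h"
      using algebra_hom_full[OF alg] by blast
    show "\<exists>f \<in> Hom (Alg F) a b. farr (kappa1 (Nuc F)) f = t"
    proof
      show "(a, f, b) \<in> Hom (Alg F) a b"
        using f alg by (simp add: Hom_def ab_eq)
      show "farr (kappa1 (Nuc F)) (a, f, b) = t"
        using f by (simp add: t' h ab_eq is_algebra_hom_iff)
    qed
  next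
    fix d assume d: "d \<in> Obj (Alg (Nuc F))"
    obtain y \<beta> a \<theta> b where d_eq: "d = ((y, \<beta>), (a, \<theta>, b))"
      by (metis surj_pair)
    note d' = d[unfolded d_eq Alg_simps is_algebra_iff Nuc_simps comp_functor_simps]
    \<comment> \<open>A structure map is itself an arrow of \<open>Coalg F\<close>, a triple that
      records its ends; the typing condition in \<open>is_algebra\<close> fixes them.\<close>
    have ab: "a = (Lo (Ro y), L (\<eta> (Ro y)))" "b = (y, \<beta>)"
      using d' by simp_all
    have \<beta>: "coalgebra (y, \<beta>)" using d' by simp
    note \<beta>' = \<beta>[unfolded is_coalgebra_iff comp_functor_simps]
    have "is_coalgebra_hom (catB F) (ladj F \<circ>\<^sub>F radj F)
        ((Lo (Ro y), L (\<eta> (Ro y))), \<theta>, (y, \<beta>))"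
      using d' by (simp add: ab)
    note \<theta> = this[unfolded is_coalgebra_hom_iff comp_functor_simps]
    have \<theta>': "\<theta> \<cdot>\<^sub>B \<beta> = Id (catB F) y" "\<theta> \<cdot>\<^sub>B L (R \<theta>) = \<theta> \<cdot>\<^sub>B L (R (\<epsilon> y))"
      using d' \<theta> \<beta>' by (simp_all add: ab)
    obtain x \<alpha> i where x: "algebra (x, \<alpha>)"
      and i: "i \<in> Arr (catB F)" "Dom (catB F) i = Lo x" "Cod (catB F) i = y" "is_iso (catB F) i"
      and e: "L (R i) \<cdot>\<^sub>B L (\<eta> x) = \<beta> \<cdot>\<^sub>B i" "i \<cdot>\<^sub>B L \<alpha> = \<theta> \<cdot>\<^sub>B L (R i)"
      using algebra_ess_surj[OF assms, of y \<beta> \<theta>] \<beta>' \<theta> \<theta>' by blast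
    \<comment> \<open>The isomorphism is lifted twice, from \<open>catB F\<close> to
      \<open>Coalg F\<close> as \<open>j\<close> and from there to \<open>Alg (Nuc F)\<close> as
      \<open>k\<close>; invertibility passes up through \<open>is_iso_Coalg\<close> and
      \<open>is_iso_Alg\<close>.\<close>
    define j where "j = ((Lo x, L (\<eta> x)), i, (y, \<beta>))"
    define k where "k = (fobj (kappa1 (Nuc F)) (x, \<alpha>), j, d)"
    note x' = x[unfolded is_algebra_iff comp_functor_simps]
    have j: "j \<in> Arr (Coalg F)"
      using x' i e \<beta> by (simp add: j_def is_coalgebra_hom_iff coalgebra_kappa0)
    have "is_algebra_hom (Coalg F) (radj (Nuc F) \<circ>\<^sub>F ladj (Nuc F)) k"
      using j x' i(1-3) e(2) by (simp add: k_def j_def d_eq ab is_algebra_hom_iff)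
    moreover have "fobj (kappa1 (Nuc F)) (x, \<alpha>) \<in> Obj (Alg (Nuc F))"
      using N.algebra_kappa1[of "(x, \<alpha>)"] x by (simp only: Alg_simps kappa_simps Nuc_simps)
    ultimately have k: "k \<in> Arr (Alg (Nuc F))"
      using d by (simp only: k_def Alg_simps(2) Nuc_simps(1))
    show "\<exists>c \<in> Obj (Alg F). \<exists>i \<in> Hom (Alg (Nuc F)) (fobj (kappa1 (Nuc F)) c) d.
        is_iso (Alg (Nuc F)) i"
    proof (intro bexI)
      show "is_iso (Alg (Nuc F)) k"
        using N.is_iso_Alg[OF k[unfolded k_def]] is_iso_Coalg[OF j[unfolded j_def]] i(4)
        by (simp add: k_def j_def)
      show "k \<in> Hom (Alg (Nuc F)) (fobj (kappa1 (Nuc F)) (x, \<alpha>)) d"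
        using k by (intro HomI) (simp_all only: k_def Alg_simps)
      show "(x, \<alpha>) \<in> Obj (Alg F)" using x by simp
    qed
  qed
  then show ?thesis by (simp add: monadic_def)
qed

text \<open>\<open>Nuc (op_adj F)\<close> and \<open>op_adj (Nuc F)\<close> are different records,
  since the triples serving as arrows are reversed. Hence duality is used only for the lemmas about
  \<open>F\<close> itself, and the packaging into triples is repeated.\<close>

lemma comonadic_Nuc:
  assumes "idempotents_split (catB F)"
  shows "comonadic (Nuc F)"
proof -
  interpret N: adjunction "Nuc F" by (rule adjunction_Nuc)
  have "is_equivalence (Coalg F) (Coalg (Nuc F)) (kappa0 (Nuc F))"
  proof (rule is_equivalenceI)
    show "cfunctor (Coalg F) (Coalg (Nuc F)) (kappa0 (Nuc F))"
      using N.cfunctor_kappa0 by simp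
  next
    fix a b s t
    assume s: "s \<in> Hom (Coalg F) a b" and t: "t \<in> Hom (Coalg F) a b"
      and eq: "farr (kappa0 (Nuc F)) s = farr (kappa0 (Nuc F)) t"
    obtain x \<alpha> y \<beta> where ab: "a = (x, \<alpha>)" "b = (y, \<beta>)"
      by (metis surj_pair)
    obtain f g where fg: "s = (a, f, b)" "t = (a, g, b)"
      using s t by (cases s; cases t) (simp add: Hom_def)
    have "f = g"
    proof (rule coalgebra_hom_faithful)
      show "R f = R g" using eq by (simp add: fg)
    qed (use s t in \<open>simp_all add: Hom_def ab fg\<close>)
    then show "s = t" by (simp add: fg)
  next
    fix a b t
    assume ab: "a \<in> Obj (Coalg F)" "b \<in> Obj (Coalg F)"
      and t: "t \<in> Hom (Coalg (Nuc F)) (fobj (kappa0 (Nuc F)) a) (fobj (kappa0 (Nuc F)) b)"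
    obtain x \<alpha> y \<beta> where ab_eq: "a = (x, \<alpha>)" "b = (y, \<beta>)"
      by (metis surj_pair)
    have coalg: "coalgebra (x, \<alpha>)" "coalgebra (y, \<beta>)" using ab by (simp_all add: ab_eq)
    note coalg' = coalg[unfolded is_coalgebra_iff comp_functor_simps]
    obtain t' where t': "t = (fobj (kappa0 (Nuc F)) a, t', fobj (kappa0 (Nuc F)) b)"
      using t by (cases t) (simp add: Hom_def)
    have hom: "is_coalgebra_hom (Alg F) (ladj (Nuc F) \<circ>\<^sub>F radj (Nuc F))
        (fobj (kappa0 (Nuc F)) a, t', fobj (kappa0 (Nuc F)) b)"
      using t unfolding t' Hom_def by simp
    obtain h where h: "t' = ((Ro x, R (\<epsilon> x)), h, (Ro y, R (\<epsilon> y)))"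
      using hom by (cases t') (simp add: is_coalgebra_hom_iff ab_eq)
    have h_hom: "h \<in> Arr (catA F)" "Dom (catA F) h = Ro x" "Cod (catA F) h = Ro y"
      "h \<cdot>\<^sub>A R (\<epsilon> x) = R (\<epsilon> y) \<cdot>\<^sub>A R (L h)"
      using hom by (simp_all add: is_coalgebra_hom_iff ab_eq h is_algebra_hom_iff)
    moreover have "R (L h) \<cdot>\<^sub>A R \<alpha> = R \<beta> \<cdot>\<^sub>A h"
      using hom coalg' h_hom by (simp add: is_coalgebra_hom_iff ab_eq h)
    ultimately obtain f
      where f: "is_coalgebra_hom (catB F) (ladj F \<circ>\<^sub>F radj F) ((x, \<alpha>), f, (y, \<beta>))" "R f = h"
      using coalgebra_hom_full[OF coalg] by blast
    show "\<exists>f \<in> Hom (Coalg F) a b. farr (kappa0 (Nuc F)) f = t"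
    proof
      show "(a, f, b) \<in> Hom (Coalg F) a b"
        using f coalg by (simp add: Hom_def ab_eq)
      show "farr (kappa0 (Nuc F)) (a, f, b) = t"
        using f by (simp add: t' h ab_eq is_coalgebra_hom_iff)
    qed
  next
    fix d assume d: "d \<in> Obj (Coalg (Nuc F))"
    obtain x \<alpha> a \<theta> b where d_eq: "d = ((x, \<alpha>), (a, \<theta>, b))"
      by (metis surj_pair)
    note d' = d[unfolded d_eq Coalg_simps is_coalgebra_iff Nuc_simps comp_functor_simps]
    have ab: "a = (x, \<alpha>)" "b = (Ro (Lo x), R (\<epsilon> (Lo x)))"
      using d' by simp_all
    have \<alpha>: "algebra (x, \<alpha>)" using d' by simp
    note \<alpha>' = \<alpha>[unfolded is_algebra_iff comp_functor_simps]
    have "is_algebra_hom (catA F) (radj F \<circ>\<^sub>F ladj F)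
        ((x, \<alpha>), \<theta>, (Ro (Lo x), R (\<epsilon> (Lo x))))"
      using d' by (simp add: ab)
    note \<theta> = this[unfolded is_algebra_hom_iff comp_functor_simps]
    have \<theta>': "\<alpha> \<cdot>\<^sub>A \<theta> = Id (catA F) x" "R (L \<theta>) \<cdot>\<^sub>A \<theta> = R (L (\<eta> x)) \<cdot>\<^sub>A \<theta>"
      using d' \<theta> \<alpha>' by (simp_all add: ab)
    have "\<exists>y \<beta> i. coalgebra (y, \<beta>) \<and>
        i \<in> Arr (catA F) \<and> Dom (catA F) i = x \<and> Cod (catA F) i = Ro y \<and> is_iso (catA F) i \<and>
        R (\<epsilon> y) \<cdot>\<^sub>A R (L i) = i \<cdot>\<^sub>A \<alpha> \<and> R \<beta> \<cdot>\<^sub>A i = R (L i) \<cdot>\<^sub>A \<theta>"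
      by (rule coalgebra_ess_surj[OF assms]) (use \<alpha>' \<theta> \<theta>' in simp_all)
    then obtain y \<beta> i where y: "coalgebra (y, \<beta>)"
      and i: "i \<in> Arr (catA F)" "Dom (catA F) i = x" "Cod (catA F) i = Ro y" "is_iso (catA F) i"
      and e: "R (\<epsilon> y) \<cdot>\<^sub>A R (L i) = i \<cdot>\<^sub>A \<alpha>" "R \<beta> \<cdot>\<^sub>A i = R (L i) \<cdot>\<^sub>A \<theta>"
      by blast
    note y' = y[unfolded is_coalgebra_iff comp_functor_simps]
    define j where "j = ((x, \<alpha>), i, (Ro y, R (\<epsilon> y)))"
    define k where "k = (d, j, fobj (kappa0 (Nuc F)) (y, \<beta>))"
    have j: "j \<in> Arr (Alg F)"
      using y' i e \<alpha> by (simp add: j_def is_algebra_hom_iff algebra_kappa1)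
    have "is_coalgebra_hom (Alg F) (ladj (Nuc F) \<circ>\<^sub>F radj (Nuc F)) k"
      using j y' i(1-3) e(2) by (simp add: k_def j_def d_eq ab is_coalgebra_hom_iff)
    moreover have "fobj (kappa0 (Nuc F)) (y, \<beta>) \<in> Obj (Coalg (Nuc F))"
      using N.coalgebra_kappa0[of "(y, \<beta>)"] y by (simp only: Coalg_simps kappa_simps Nuc_simps)
    ultimately have k: "k \<in> Arr (Coalg (Nuc F))"
      using d by (simp only: k_def Coalg_simps(2) Nuc_simps(2))
    have "is_iso (Coalg (Nuc F)) k"
      using N.is_iso_Coalg[OF k[unfolded k_def]] is_iso_Alg[OF j[unfolded j_def]] i(4)
      by (simp add: k_def j_def)
    moreover have "k \<in> Hom (Coalg (Nuc F)) d (fobj (kappa0 (Nuc F)) (y, \<beta>))"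
      using k by (intro HomI) (simp_all only: k_def Coalg_simps)
    \<comment> \<open>\<open>k\<close> starts at \<open>d\<close>, whereas essential surjectivity
      asks for an isomorphism into \<open>d\<close>.\<close>
    ultimately have "\<exists>k' \<in> Hom (Coalg (Nuc F)) (fobj (kappa0 (Nuc F)) (y, \<beta>)) d.
        is_iso (Coalg (Nuc F)) k'"
      by (rule category.is_iso_inverse[OF N.category_Coalg])
    then show "\<exists>c \<in> Obj (Coalg F). \<exists>i \<in> Hom (Coalg (Nuc F)) (fobj (kappa0 (Nuc F)) c) d.
        is_iso (Coalg (Nuc F)) i"
      using y by (intro bexI[of _ "(y, \<beta>)"]) simp_all
  qed
  then show ?thesis by (simp add: comonadic_def)
qed

end

text \<open>\<open>nuclear\<close> is defined for arbitrary records of type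
  \<open>adjunction\<close>, so the adjunction laws for \<open>Nuc F\<close> are asserted alongside
  it.\<close>

theorem mainTheorem1:
  fixes F :: "('oa, 'ma, 'ob, 'mb) adjunction"
  assumes "adjunction F"
    and "idempotents_split (catA F)"
    and "idempotents_split (catB F)"
  shows "adjunction (Nuc F) \<and> nuclear (Nuc F)"
  using assms adjunction.adjunction_Nuc adjunction.monadic_Nuc adjunction.comonadic_Nuc
  unfolding nuclear_def by blast

end
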